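(* Let $m_1,m_2\ge 1$ be integers, $m=m_1+m_2$, let $A\in\mathbb{R}^{m\times m}$, $z\in\mathbb{R}^m$, and let $\alpha,\beta\in(0,1]$. The solution of the fractional index-2 system $$D_t^{\alpha,\beta}y(t)=A\,y(t),\qquad y(0)=z,$$ is given by $$y(t)=\sum_{n=0}^{\infty}L_n\,p_n(t)\,z ,$$ where $L_0=I_m$, $p_0(t)=I_m$, and for $n=1,2,\dots$ the matrices $L_n\in\mathbb{R}^{m\times m(n+1)}$ are defined recursively as follows: partition the $m\times mn$ matrix $A L_{n-1}$ as $$A L_{n-1}=\begin{pmatrix}\alpha_{n1}&\cdots&\alpha_{nn}\\ \beta_{n1}&\cdots&\beta_{nn}\end{pmatrix},\qquad \alpha_{nj}\in\mathbb{R}^{m_1\times m},\ \beta_{nj}\in\mathbb{R}^{m_2\times m},$$ and set $$L_n=\begin{pmatrix}\alpha_{n1}&\alpha_{n2}&\cdots&\alpha_{nn}&0\\ 0&\beta_{n1}&\cdots&\beta_{n,n-1}&\beta_{nn}\end{pmatrix}$$ (the zeros being zero blocks of sizes $m_1\times m$ and $m_2\times m$), and $$p_n(t)=\left(\frac{t^{n\alpha}}{\Gamma(1+n\alpha)},\ \frac{t^{(n-1)\alpha+\beta}}{\Gamma(1+(n-1)\alpha+\beta)},\ \dots,\ \frac{t^{n\beta}}{\Gamma(1+n\beta)}\right)^{\top}\otimes I_m\in\mathbb{R}^{m(n+1)\times m}.$$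
   Context: For $0<\gamma<1$ the Caputo derivative with starting point $0$ is $D_t^{\gamma}u(t)=\frac{1}{\Gamma(1-\gamma)}\int_0^t\frac{u'(s)}{(t-s)^{\gamma}}\,ds$, and $D_t^{1}u=u'$; it acts componentwise on vector functions. For $y=(y_1^\top,y_2^\top)^\top$ with $y_1(t)\in\mathbb{R}^{m_1}$, $y_2(t)\in\mathbb{R}^{m_2}$, the notation $D_t^{\alpha,\beta}y$ means $\big((D_t^{\alpha}y_1)^\top,(D_t^{\beta}y_2)^\top\big)^\top$, i.e. the index $\alpha$ is applied to the first block and the index $\beta$ to the second. $\Gamma$ is the Gamma function, $I_m$ is the $m\times m$ identity matrix, and $\otimes$ is the Kronecker product. The entry of $p_n(t)$ in position $j$ ($j=0,\dots,n$) before the Kronecker product is $t^{(n-j)\alpha+j\beta}/\Gamma(1+(n-j)\alpha+j\beta)$. *)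

theory Defs
  imports "HOL-Analysis.Analysis" "Jordan_Normal_Form.Matrix"
begin

no_notation vec_nth (infixl \<open>$\<close> 90)

text \<open>
  The Caputo derivative with starting point 0 at a time \<open>t > 0\<close>, for orders in \<open>(0, 1]\<close>.
  Since \<^const>\<open>deriv\<close> and the Lebesgue integral are total, whether the derivative exists is
  expressed separately. For \<open>\<gamma> < 1\<close>, integrability of the kernel on \<open>(0, t)\<close> implies
  integrability of \<open>u'\<close> there, because \<open>(t - s) powr \<gamma> \<le> t powr \<gamma>\<close>.
\<close>

definition caputo_deriv :: "real \<Rightarrow> (real \<Rightarrow> real) \<Rightarrow> real \<Rightarrow> real" where
  "caputo_deriv \<gamma> u t =
    (if \<gamma> = 1 then deriv u t
     else 1 / Gamma (1 - \<gamma>) * (LBINT s:{0<..<t}. deriv u s / (t - s) powr \<gamma>))"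

definition caputo_differentiable :: "real \<Rightarrow> (real \<Rightarrow> real) \<Rightarrow> real \<Rightarrow> bool" where
  "caputo_differentiable \<gamma> u t \<longleftrightarrow>
    (if \<gamma> = 1 then u differentiable (at t)
     else (\<forall>s\<in>{0<..<t}. u differentiable (at s)) \<and>
          set_integrable lborel {0<..<t} (\<lambda>s. deriv u s / (t - s) powr \<gamma>))"

definition block_index :: "nat \<Rightarrow> real \<Rightarrow> real \<Rightarrow> nat \<Rightarrow> real" where
  "block_index m1 \<alpha> \<beta> i = (if i < m1 then \<alpha> else \<beta>)"

definition caputo_deriv_vec ::
    "nat \<Rightarrow> nat \<Rightarrow> real \<Rightarrow> real \<Rightarrow> (real \<Rightarrow> real Matrix.vec) \<Rightarrow> real \<Rightarrow> real Matrix.vec" where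
  "caputo_deriv_vec m1 m2 \<alpha> \<beta> y t =
    Matrix.vec (m1 + m2) (\<lambda>i. caputo_deriv (block_index m1 \<alpha> \<beta> i) (\<lambda>s. y s $ i) t)"

text \<open>
  A solution is continuous on \<open>[0, \<infinity>)\<close> and satisfies the equation at every \<open>t > 0\<close>. The
  equation is not imposed at \<open>t = 0\<close>: for orders below 1 the defining integral is empty there,
  while \<open>A z\<close> need not vanish.
\<close>

definition solves_fde ::
    "nat \<Rightarrow> nat \<Rightarrow> real \<Rightarrow> real \<Rightarrow> real Matrix.mat \<Rightarrow> real Matrix.vec
      \<Rightarrow> (real \<Rightarrow> real Matrix.vec) \<Rightarrow> bool" where
  "solves_fde m1 m2 \<alpha> \<beta> A z y \<longleftrightarrow>
    (\<forall>t\<ge>0. y t \<in> carrier_vec (m1 + m2)) \<and>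
    (\<forall>i<m1 + m2. continuous_on {0..} (\<lambda>t. y t $ i)) \<and>
    y 0 = z \<and>
    (\<forall>t>0. (\<forall>i<m1 + m2. caputo_differentiable (block_index m1 \<alpha> \<beta> i) (\<lambda>s. y s $ i) t) \<and>
           caputo_deriv_vec m1 m2 \<alpha> \<beta> y t = A *\<^sub>v y t)"

definition kronecker :: "real Matrix.mat \<Rightarrow> real Matrix.mat \<Rightarrow> real Matrix.mat"
    (infixl \<open>\<otimes>\<^sub>K\<close> 70) where
  "A \<otimes>\<^sub>K B = Matrix.mat (dim_row A * dim_row B) (dim_col A * dim_col B)
    (\<lambda>(i, j). A $$ (i div dim_row B, j div dim_col B) * B $$ (i mod dim_row B, j mod dim_col B))"

text \<open>
  \<open>shift_blocks m1 m B\<close> appends a zero block of \<open>m\<close> columns to the first \<open>m1\<close> rows of \<open>B\<close>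
  on the right, and to the remaining rows on the left.
\<close>

definition shift_blocks :: "nat \<Rightarrow> nat \<Rightarrow> real Matrix.mat \<Rightarrow> real Matrix.mat" where
  "shift_blocks m1 m B = Matrix.mat (dim_row B) (dim_col B + m)
    (\<lambda>(i, k). if i < m1 then (if k < dim_col B then B $$ (i, k) else 0)
              else (if k < m then 0 else B $$ (i, k - m)))"

primrec L_mat :: "nat \<Rightarrow> nat \<Rightarrow> real Matrix.mat \<Rightarrow> nat \<Rightarrow> real Matrix.mat" where
  "L_mat m1 m2 A 0 = 1\<^sub>m (m1 + m2)"
| "L_mat m1 m2 A (Suc n) = shift_blocks m1 (m1 + m2) (A * L_mat m1 m2 A n)"

lemma L_mat_carrier:
  assumes "A \<in> carrier_mat (m1 + m2) (m1 + m2)"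
  shows "L_mat m1 m2 A n \<in> carrier_mat (m1 + m2) ((m1 + m2) * (n + 1))"
  using assms by (induction n) (auto simp: shift_blocks_def)

text \<open>
  The case \<open>n = 0\<close> is separate because \<open>0 powr 0 = 0\<close>; for \<open>n > 0\<close> and positive orders all
  exponents below are positive.
\<close>

definition p_mat :: "nat \<Rightarrow> real \<Rightarrow> real \<Rightarrow> nat \<Rightarrow> real \<Rightarrow> real Matrix.mat" where
  "p_mat m \<alpha> \<beta> n t =
    (if n = 0 then 1\<^sub>m m
     else Matrix.mat (n + 1) 1
            (\<lambda>(j, _). t powr (real (n - j) * \<alpha> + real j * \<beta>)
                      / Gamma (1 + real (n - j) * \<alpha> + real j * \<beta>))
          \<otimes>\<^sub>K 1\<^sub>m m)"

lemma p_mat_carrier: "p_mat m \<alpha> \<beta> n t \<in> carrier_mat (m * (n + 1)) m"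
  by (auto simp: p_mat_def kronecker_def)

definition series_term ::
    "nat \<Rightarrow> nat \<Rightarrow> real \<Rightarrow> real \<Rightarrow> real Matrix.mat \<Rightarrow> real Matrix.vec \<Rightarrow> real \<Rightarrow> nat \<Rightarrow> real Matrix.vec"
  where
  "series_term m1 m2 \<alpha> \<beta> A z t n = (L_mat m1 m2 A n * p_mat (m1 + m2) \<alpha> \<beta> n t) *\<^sub>v z"

definition series_solution ::
    "nat \<Rightarrow> nat \<Rightarrow> real \<Rightarrow> real \<Rightarrow> real Matrix.mat \<Rightarrow> real Matrix.vec \<Rightarrow> real \<Rightarrow> real Matrix.vec" where
  "series_solution m1 m2 \<alpha> \<beta> A z t =
    Matrix.vec (m1 + m2) (\<lambda>i. \<Sum>n. series_term m1 m2 \<alpha> \<beta> A z t n $ i)"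

end

theory Submission
  imports Defs
begin

text \<open>
  Row \<open>i\<close> of the \<open>(n + 1)\<close>-st term of the series is the fractional integral, of the order belonging
  to that row, of \<open>A\<close> times the \<open>n\<close>-th term: shifting the blocks of \<open>A L_n\<close> to the left or to the right
  records whether the exponent grows by \<open>\<alpha>\<close> or by \<open>\<beta>\<close>. Since \<open>x powr e \<le> Gamma (1 + e) * exp x\<close>,
  all terms are dominated by \<open>K * (1/4) ^ n * exp (lam * t)\<close> for a suitable \<open>lam\<close>, which justifies
  termwise differentiation and, by a Beta integral for each power, termwise Caputo differentiation.
  Conversely, composing the Caputo derivative with the fractional integral (Fubini and the same
  Beta integral) turns every solution into a solution of a Volterra equation with weakly singular
  kernel, which is unique because the Volterra operator is a contraction in an exponentially
  weighted sup norm.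
\<close>

section \<open>Powers, the Gamma function and the Abel kernel\<close>

text \<open>Compares the Gamma integral with its tail over \<open>{x..}\<close>, where
  \<open>s powr e\<close> is at least \<open>x powr e\<close>.\<close>

lemma powr_le_Gamma_exp:
  fixes x e :: real
  assumes "0 < x" "0 \<le> e"
  shows "x powr e \<le> Gamma (1 + e) * exp x"
proof -
  let ?g = "\<lambda>s. if s \<in> {x..} then x powr e * exp (- s) else 0"
  have "((\<lambda>s. x powr e * exp (- s)) has_integral x powr e * exp (- x)) {x..}"
    using has_integral_mult_right[OF has_integral_exp_minus_to_infinity[of 1 x], of "x powr e"]
    by simp
  then have "(?g has_integral x powr e * exp (- x)) {0..}"
    using assms by (subst has_integral_restrict) auto
  moreover have "((\<lambda>s. s powr e / exp s) has_integral Gamma (1 + e)) {0..}"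
    using Gamma_integral_real[of "1 + e"] assms by simp
  moreover have "?g s \<le> s powr e / exp s" for s
    using assms by (auto simp: exp_minus divide_simps intro!: powr_mono2)
  ultimately have "x powr e * exp (- x) \<le> Gamma (1 + e)"
    by (blast intro: has_integral_le)
  then show ?thesis
    by (simp add: exp_minus field_simps)
qed

text \<open>The rate \<open>lam\<close> stays free: taken large, the factor
  \<open>lam powr (- e)\<close> later absorbs the growth of the coefficients.\<close>

lemma powr_div_Gamma_le:
  fixes t lam e :: real
  assumes "0 < t" "0 < lam" "0 \<le> e"
  shows "t powr e / Gamma (1 + e) \<le> lam powr (- e) * exp (lam * t)"
proof -
  have "lam powr e * t powr e \<le> Gamma (1 + e) * exp (lam * t)"
    using powr_le_Gamma_exp[of "lam * t" e] assms by (simp add: powr_mult)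
  moreover have "Gamma (1 + e) > 0" "lam powr e > 0"
    using assms by (auto intro: Gamma_real_pos)
  ultimately show ?thesis
    by (simp add: powr_minus field_simps)
qed

lemma powr_div_Gamma_deriv:
  fixes t e :: real
  assumes "0 < t" "0 < e"
  shows "((\<lambda>s. s powr e / Gamma (1 + e)) has_field_derivative t powr (e - 1) / Gamma e) (at t)"
proof -
  have "e \<notin> \<int>\<^sub>\<le>\<^sub>0"
    using assms by (auto elim!: nonpos_Ints_cases)
  then have "Gamma (1 + e) = e * Gamma e"
    using Gamma_plus1[of e] by (simp add: add.commute)
  moreover have "Gamma e \<noteq> 0"
    using Gamma_real_pos[OF assms(2)] by (metis less_irrefl)
  ultimately show ?thesis
    using assms by (auto intro!: derivative_eq_intros)
qed

text \<open>The affine substitution \<open>(s - r) / (t - r)\<close> reduces it to the Beta integral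
  on \<open>{0<..<1}\<close>. The lower limit \<open>r\<close> varies when Fubini is applied and is
  0 for the powers of the series.\<close>

lemma has_bochner_integral_Beta_kernel:
  fixes a b r t :: real
  assumes "0 < a" "0 < b" "r < t"
  shows "has_bochner_integral lborel
    (\<lambda>s. indicator {r<..<t} s * ((s - r) powr (a - 1) * (t - s) powr (b - 1)))
    ((t - r) powr (a + b - 1) * Beta a b)"
proof -
  let ?B = "\<lambda>s :: real. indicator {0<..<1} s * (s powr (a - 1) * (1 - s) powr (b - 1))"
  define c where "c = 1 / (t - r)"
  have c: "c > 0"
    using assms by (simp add: c_def)
  have "((\<lambda>s. s powr (a - 1) * (1 - s) powr (b - 1)) has_integral Beta a b) {0<..<1}"
    using has_integral_Beta_real[OF assms(1,2)] by (simp add: has_integral_Icc_iff_Ioo)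
  from nn_integral_has_integral_lebesgue[OF _ this]
  have "has_bochner_integral lborel ?B (Beta a b)"
    using assms by (intro has_bochner_integral_nn_integral)
      (auto simp: Beta_def intro!: divide_nonneg_nonneg mult_nonneg_nonneg Gamma_real_nonneg)
  then have "has_bochner_integral lborel (\<lambda>s. ?B (- c * r + c * s)) (Beta a b / c)"
    using c by (subst (asm) lborel_has_bochner_integral_real_affine_iff[of c _ _ "- c * r"])
      (auto simp: divide_inverse mult.commute)
  then have "has_bochner_integral lborel (\<lambda>s. (t - r) powr (a + b - 2) * ?B (- c * r + c * s))
      ((t - r) powr (a + b - 2) * (Beta a b / c))"
    by (rule has_bochner_integral_mult_right)
  moreover have "(t - r) powr (a + b - 2) * ?B (- c * r + c * s) =
      indicator {r<..<t} s * ((s - r) powr (a - 1) * (t - s) powr (b - 1))" for s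
  proof -
    have eq: "- c * r + c * s = (s - r) / (t - r)" "1 - (s - r) / (t - r) = (t - s) / (t - r)"
      using assms by (simp add: c_def diff_divide_distrib, simp add: field_simps)
    have "(s - r) / (t - r) \<in> {0<..<1} \<longleftrightarrow> s \<in> {r<..<t}"
      using assms by (auto simp: field_simps)
    moreover have "(t - r) powr (a + b - 2) = (t - r) powr (a - 1) * (t - r) powr (b - 1)"
      by (simp flip: powr_add)
    ultimately show ?thesis
      unfolding eq using assms by (auto simp: indicator_def powr_divide)
  qed
  moreover have "(t - r) powr (a + b - 2) * (Beta a b / c) = (t - r) powr (a + b - 1) * Beta a b"
    using assms powr_add[of "t - r" "a + b - 2" 1] by (simp add: c_def)
  ultimately show ?thesis
    by simp
qed

text \<open>Extended to the half-line \<open>{..t}\<close>, the integral becomes a Gamma integral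
  under the substitution \<open>lam * (t - s)\<close>. The factor \<open>lam powr (- g)\<close> is
  what makes the Volterra operator a contraction.\<close>

lemma exp_kernel_integral_le:
  fixes t lam g :: real
  assumes "0 < lam" "0 < g"
  shows "set_integrable lborel {0<..<t} (\<lambda>s. (t - s) powr (g - 1) * exp (lam * s))"
    and "(LBINT s:{0<..<t}. (t - s) powr (g - 1) * exp (lam * s))
      \<le> Gamma g * lam powr (- g) * exp (lam * t)"
proof -
  let ?G = "\<lambda>s :: real. indicator {0..} s * (s powr (g - 1) / exp s)"
  let ?k = "\<lambda>s. indicator {..t} s * ((t - s) powr (g - 1) * exp (lam * s))"
  have "has_bochner_integral lborel ?G (Gamma g)"
    using assms nn_integral_has_integral_lebesgue[OF _ Gamma_integral_real[OF assms(2)]]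
    by (intro has_bochner_integral_nn_integral) (auto intro!: Gamma_real_nonneg)
  then have "has_bochner_integral lborel (\<lambda>s. ?G (lam * t + (- lam) * s)) (Gamma g / lam)"
    using assms by (subst (asm) lborel_has_bochner_integral_real_affine_iff[of "- lam" _ _ "lam * t"])
      (auto simp: divide_inverse mult.commute)
  then have "has_bochner_integral lborel
      (\<lambda>s. lam powr (1 - g) * exp (lam * t) * ?G (lam * t + (- lam) * s))
      (lam powr (1 - g) * exp (lam * t) * (Gamma g / lam))"
    by (rule has_bochner_integral_mult_right)
  moreover have "lam powr (1 - g) * exp (lam * t) * ?G (lam * t + (- lam) * s) = ?k s" for s
  proof (cases "s \<le> t")
    case True
    have "lam * t + (- lam) * s = lam * (t - s)"
      by (simp add: algebra_simps)
    moreover have "lam powr (1 - g) * (lam * (t - s)) powr (g - 1) = (t - s) powr (g - 1)"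
      using assms True by (simp add: powr_mult flip: powr_add mult.assoc)
    moreover have "exp (lam * t) / exp (lam * (t - s)) = exp (lam * s)"
      by (simp flip: exp_diff add: algebra_simps)
    ultimately show ?thesis
      using assms True by (auto simp: indicator_def field_simps)
  next
    case False
    then show ?thesis
      using assms by (auto simp: indicator_def)
  qed
  moreover have "lam powr (1 - g) * exp (lam * t) * (Gamma g / lam) =
      Gamma g * lam powr (- g) * exp (lam * t)"
    using assms powr_add[of lam "- g" 1] by (simp add: field_simps)
  ultimately have k: "has_bochner_integral lborel ?k (Gamma g * lam powr (- g) * exp (lam * t))"
    by simp
  have int: "set_integrable lborel {..t} (\<lambda>s. (t - s) powr (g - 1) * exp (lam * s))"
    using k by (simp add: set_integrable_def has_bochner_integral_iff)
  then show sub: "set_integrable lborel {0<..<t} (\<lambda>s. (t - s) powr (g - 1) * exp (lam * s))"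
    by (rule set_integrable_subset) auto
  have "(LBINT s:{0<..<t}. (t - s) powr (g - 1) * exp (lam * s)) \<le> integral\<^sup>L lborel ?k"
    unfolding set_lebesgue_integral_def
    using sub k by (intro integral_mono)
      (auto simp: set_integrable_def has_bochner_integral_iff indicator_def)
  then show "(LBINT s:{0<..<t}. (t - s) powr (g - 1) * exp (lam * s))
      \<le> Gamma g * lam powr (- g) * exp (lam * t)"
    using k by (simp add: has_bochner_integral_iff)
qed

section \<open>Inverting the Caputo derivative\<close>

text \<open>The fundamental theorem with differentiability only in the interior yields a gauge
  integral; integrability of \<open>deriv u\<close> identifies it with the Lebesgue
  integral.\<close>

lemma lborel_FTC_open:
  fixes u :: "real \<Rightarrow> real"
  assumes "0 \<le> t" "continuous_on {0..t} u"
    and "\<And>s. s \<in> {0<..<t} \<Longrightarrow> u differentiable (at s)"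
    and "set_integrable lborel {0<..<t} (deriv u)"
  shows "(LBINT s:{0<..<t}. deriv u s) = u t - u 0"
proof -
  have "(deriv u has_integral (u t - u 0)) {0..t}"
    using assms(1-3)
    by (intro fundamental_theorem_of_calculus_interior)
      (auto simp flip: has_real_derivative_iff_has_vector_derivative
        simp: DERIV_deriv_iff_real_differentiable)
  then have "(deriv u has_integral (u t - u 0)) {0<..<t}"
    by (simp add: has_integral_Icc_iff_Ioo)
  moreover have "(deriv u has_integral (LBINT s:{0<..<t}. deriv u s)) {0<..<t}"
    using assms(4) set_borel_integral_eq_integral[of "{0<..<t}" "deriv u"] by auto
  ultimately show ?thesis
    by (rule has_integral_unique[symmetric])
qed

text \<open>
  By Fubini the fractional integral of order \<open>g\<close> undoes the Caputo derivative: the two kernels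
  compose to the constant \<open>Beta (1 - g) g = Gamma (1 - g) * Gamma g\<close>.
\<close>

lemma caputo_inversion_less_1:
  fixes u :: "real \<Rightarrow> real"
  assumes g: "0 < g" "g < 1" and t: "0 < t"
    and cont: "continuous_on {0..} u"
    and diff: "caputo_differentiable g u t"
  shows "(LBINT s:{0<..<t}. (t - s) powr (g - 1) * caputo_deriv g u s) = Gamma g * (u t - u 0)"
proof -
  have D: "\<And>s. s \<in> {0<..<t} \<Longrightarrow> u differentiable (at s)"
    and int: "set_integrable lborel {0<..<t} (\<lambda>s. deriv u s / (t - s) powr g)"
    using diff g by (auto simp: caputo_differentiable_def)
  define v where "v r = indicator {0<..<t} r * deriv u r" for r
  define G where "G r = indicator {0<..<t} r * (deriv u r / (t - r) powr g)" for r
  have G_int: "integrable lborel G"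
    using int by (simp add: set_integrable_def G_def[abs_def])
  then have [measurable]: "G \<in> borel_measurable borel"
    using borel_measurable_integrable by force
  have v_eq: "v = (\<lambda>r. G r * (t - r) powr g)"
    by (auto simp: v_def G_def indicator_def)
  have [measurable]: "v \<in> borel_measurable borel"
    unfolding v_eq by measurable
  \<comment> \<open>Since \<open>(t - r) powr g \<le> t powr g\<close>, the derivative is dominated
    by a constant multiple of the Caputo integrand \<open>G\<close>.\<close>
  have v_int: "integrable lborel v"
  proof (rule Bochner_Integration.integrable_bound)
    show "integrable lborel (\<lambda>r. t powr g * G r)"
      using G_int by simp
    have "norm (v r) \<le> norm (t powr g * G r)" for r
    proof (cases "r \<in> {0<..<t}")
      case True
      then have "(t - r) powr g \<le> t powr g"
        using g by (intro powr_mono2) auto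
      then have "\<bar>G r\<bar> * (t - r) powr g \<le> \<bar>G r\<bar> * t powr g"
        by (intro mult_left_mono) auto
      then show ?thesis
        by (simp add: v_eq abs_mult mult.commute)
    qed (simp add: v_def)
    then show "AE r in lborel. norm (v r) \<le> norm (t powr g * G r)"
      by simp
  qed simp
  have v_total: "integral\<^sup>L lborel v = u t - u 0"
    using lborel_FTC_open[of t u] t D v_int continuous_on_subset[OF cont, of "{0..t}"]
    by (auto simp: v_def[abs_def] set_integrable_def set_lebesgue_integral_def)
  \<comment> \<open>The product of the two Abel kernels. The indicator encodes
    \<open>r < s < t\<close>, so that Fubini can run over the whole plane.\<close>
  define k where "k r s = indicator {r<..<t} s * ((s - r) powr (- g) * (t - s) powr (g - 1))"
    for r s
  have k_nonneg: "0 \<le> k r s" for r s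
    by (auto simp: k_def)
  have k_int: "integrable lborel (k r)" "integral\<^sup>L lborel (k r) = Gamma (1 - g) * Gamma g"
    if "r < t" for r
    using has_bochner_integral_Beta_kernel[of "1 - g" g r t] g that
    by (auto simp: has_bochner_integral_iff k_def[abs_def] Beta_def)
  have k_meas [measurable]: "case_prod k \<in> borel_measurable (borel \<Otimes>\<^sub>M borel)"
    unfolding k_def[abs_def] indicator_def greaterThanLessThan_iff by measurable
  have F_int: "integrable (lborel \<Otimes>\<^sub>M lborel) (\<lambda>(r, s). v r * k r s)"
  proof (rule lborel_pair.Fubini_integrable)
    show "(\<lambda>(r, s). v r * k r s) \<in> borel_measurable (lborel \<Otimes>\<^sub>M lborel)"
      by measurable
    have "(\<integral>s. norm (v r * k r s) \<partial>lborel) = \<bar>v r\<bar> * (Gamma (1 - g) * Gamma g)" for r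
      using k_int[of r] k_nonneg by (cases "r < t") (auto simp: abs_mult v_def)
    then show "integrable lborel (\<lambda>r. \<integral>s. norm (case (r, s) of (r, s) \<Rightarrow> v r * k r s) \<partial>lborel)"
      using v_int by simp
    show "AE r in lborel. integrable lborel (\<lambda>s. case (r, s) of (r, s) \<Rightarrow> v r * k r s)"
    proof (rule AE_I2)
      fix r
      show "integrable lborel (\<lambda>s. case (r, s) of (r, s) \<Rightarrow> v r * k r s)"
        using k_int[of r] by (cases "r < t") (auto simp: v_def)
    qed
  qed
  have "(\<integral>s. (\<integral>r. v r * k r s \<partial>lborel) \<partial>lborel) = (\<integral>r. (\<integral>s. v r * k r s \<partial>lborel) \<partial>lborel)"
    using lborel_pair.Fubini_integral[OF F_int] .
  also have "(\<lambda>r. \<integral>s. v r * k r s \<partial>lborel) = (\<lambda>r. v r * (Gamma (1 - g) * Gamma g))"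
  proof
    fix r
    show "(\<integral>s. v r * k r s \<partial>lborel) = v r * (Gamma (1 - g) * Gamma g)"
      using k_int[of r] by (cases "r < t") (auto simp: v_def)
  qed
  also have "(\<integral>r. v r * (Gamma (1 - g) * Gamma g) \<partial>lborel) = (u t - u 0) * (Gamma (1 - g) * Gamma g)"
    by (simp add: v_total)
  also have "(\<lambda>s. \<integral>r. v r * k r s \<partial>lborel) =
    (\<lambda>s. Gamma (1 - g) * (indicator {0<..<t} s * ((t - s) powr (g - 1) * caputo_deriv g u s)))"
  proof
    fix s
    \<comment> \<open>The conditions \<open>0 < r < t\<close> and \<open>r < s < t\<close> amount to
      \<open>0 < s < t\<close> and \<open>0 < r < s\<close>. Constants are then pulled out by a rule
      that holds whether or not the inner integral exists, so the Caputo integrals at times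
      \<open>s < t\<close> call for no separate existence proof.\<close>
    have "v r * k r s = indicator {0<..<t} s * (t - s) powr (g - 1) *
        (indicator {0<..<s} r * (deriv u r / (s - r) powr g))" for r
      by (auto simp: v_def k_def indicator_def powr_minus field_simps)
    then have "(\<integral>r. v r * k r s \<partial>lborel) = indicator {0<..<t} s * (t - s) powr (g - 1) *
        (LBINT r:{0<..<s}. deriv u r / (s - r) powr g)"
      by (simp only: set_lebesgue_integral_def real_scaleR_def integral_mult_right_zero)
    also have "(LBINT r:{0<..<s}. deriv u r / (s - r) powr g) = Gamma (1 - g) * caputo_deriv g u s"
      using g Gamma_real_pos[of "1 - g"] by (simp add: caputo_deriv_def less_imp_neq[symmetric])
    finally show "(\<integral>r. v r * k r s \<partial>lborel) =
        Gamma (1 - g) * (indicator {0<..<t} s * ((t - s) powr (g - 1) * caputo_deriv g u s))"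
      by simp
  qed
  finally have "Gamma (1 - g) * (LBINT s:{0<..<t}. (t - s) powr (g - 1) * caputo_deriv g u s) =
      (u t - u 0) * (Gamma (1 - g) * Gamma g)"
    by (simp only: set_lebesgue_integral_def real_scaleR_def integral_mult_right_zero)
  then have "Gamma (1 - g) * (LBINT s:{0<..<t}. (t - s) powr (g - 1) * caputo_deriv g u s) =
      Gamma (1 - g) * (Gamma g * (u t - u 0))"
    by (simp only: mult_ac)
  then show ?thesis
    using g Gamma_real_pos[of "1 - g"] by (simp add: less_imp_neq[symmetric])
qed

text \<open>For order 1 the kernel equals 1 on \<open>{0<..<t}\<close> and the claim is the
  fundamental theorem; there \<open>deriv u\<close> is integrable because it agrees with the
  continuous \<open>f\<close>. Smaller orders reduce to the Fubini argument.\<close>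

lemma caputo_inversion:
  fixes u f :: "real \<Rightarrow> real"
  assumes g: "0 < g" "g \<le> 1" and t: "0 < t"
    and cont: "continuous_on {0..} u" and f_cont: "continuous_on {0..} f"
    and diff: "\<And>s. 0 < s \<Longrightarrow> caputo_differentiable g u s"
    and eq: "\<And>s. 0 < s \<Longrightarrow> caputo_deriv g u s = f s"
  shows "(LBINT s:{0<..<t}. (t - s) powr (g - 1) * f s) = Gamma g * (u t - u 0)"
proof (cases "g = 1")
  case True
  have deriv: "deriv u s = f s" if "s > 0" for s
    using eq[OF that] True by (simp add: caputo_deriv_def)
  have "set_integrable lborel {0..t} f"
    by (intro borel_integrable_atLeastAtMost' continuous_on_subset[OF f_cont]) auto
  then have "set_integrable lborel {0<..<t} f"
    by (rule set_integrable_subset) auto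
  then have "set_integrable lborel {0<..<t} (deriv u)"
    by (rule set_integrable_cong[THEN iffD1, rotated -1]) (auto simp: deriv)
  then have "(LBINT s:{0<..<t}. deriv u s) = u t - u 0"
    using t diff True cont
    by (intro lborel_FTC_open) (auto simp: caputo_differentiable_def intro: continuous_on_subset)
  moreover have "(LBINT s:{0<..<t}. (t - s) powr (g - 1) * f s) = (LBINT s:{0<..<t}. deriv u s)"
    using True by (intro set_lebesgue_integral_cong) (auto simp: deriv)
  ultimately show ?thesis
    using True by simp
next
  case False
  have "(LBINT s:{0<..<t}. (t - s) powr (g - 1) * f s) =
      (LBINT s:{0<..<t}. (t - s) powr (g - 1) * caputo_deriv g u s)"
    by (intro set_lebesgue_integral_cong) (auto simp: eq)
  then show ?thesis
    using caputo_inversion_less_1[of g t u] g False t cont diff by simp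
qed

section \<open>Uniqueness for the Volterra equation\<close>

text \<open>On the compact \<open>{0..t}\<close> the continuous \<open>f\<close> is bounded, so the
  integrand is dominated by a multiple of an integrable kernel.\<close>

lemma kernel_integrable:
  fixes f :: "real \<Rightarrow> real"
  assumes "0 < g" "continuous_on {0..} f"
  shows "set_integrable lborel {0<..<t} (\<lambda>s. (t - s) powr (g - 1) * f s)"
proof -
  have "compact (f ` {0..t})"
    by (intro compact_continuous_image continuous_on_subset[OF assms(2)]) auto
  then obtain M where "\<forall>x\<in>f ` {0..t}. norm x \<le> M"
    using compact_imp_bounded bounded_iff by metis
  then have M: "\<bar>f s\<bar> \<le> M" if "s \<in> {0<..<t}" for s
    using that by auto
  \<comment> \<open>\<open>f\<close> is controlled only on \<open>{0..}\<close>, so measurability is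
    obtained for its restriction, which agrees with it on \<open>{0<..<t}\<close>.\<close>
  have [measurable]: "(\<lambda>s. indicator {0..} s *\<^sub>R f s) \<in> borel_measurable borel"
    using assms(2) by (intro borel_measurable_continuous_on_indicator) auto
  have eq: "indicator {0<..<t} s *\<^sub>R ((t - s) powr (g - 1) * f s) =
      indicator {0<..<t} s * (t - s) powr (g - 1) * (indicator {0..} s *\<^sub>R f s)" for s
    by (auto simp: indicator_def)
  show ?thesis
  proof (rule set_integrable_bound)
    \<comment> \<open>The exponential is at least 1 here; it only brings the majorant into the form
      of \<open>exp_kernel_integral_le\<close>.\<close>
    show "set_integrable lborel {0<..<t} (\<lambda>s. M * ((t - s) powr (g - 1) * exp (1 * s)))"
      using exp_kernel_integral_le(1)[of 1 g t] assms by (intro set_integrable_mult_right) auto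
    show "set_borel_measurable lborel {0<..<t} (\<lambda>s. (t - s) powr (g - 1) * f s)"
      unfolding set_borel_measurable_def eq by measurable
    have "norm ((t - s) powr (g - 1) * f s) \<le> norm (M * ((t - s) powr (g - 1) * exp (1 * s)))"
      if "s \<in> {0<..<t}" for s
    proof -
      have "\<bar>f s\<bar> * 1 \<le> M * exp s"
        using M[OF that] that by (intro mult_mono) auto
      then have "(t - s) powr (g - 1) * \<bar>f s\<bar> \<le> (t - s) powr (g - 1) * (M * exp s)"
        by (intro mult_left_mono) auto
      then show ?thesis
        using M[OF that] by (simp add: abs_mult mult_ac)
    qed
    then show "AE s in lborel. s \<in> {0<..<t} \<longrightarrow>
        norm ((t - s) powr (g - 1) * f s) \<le> norm (M * ((t - s) powr (g - 1) * exp (1 * s)))"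
      by auto
  qed
qed

lemma kernel_integral_bound:
  fixes f :: "real \<Rightarrow> real"
  assumes "0 < lam" "0 < g" "0 \<le> M"
    and "\<And>s. s \<in> {0<..<t} \<Longrightarrow> \<bar>f s\<bar> \<le> M * exp (lam * s)"
  shows "\<bar>LBINT s:{0<..<t}. (t - s) powr (g - 1) * f s\<bar> \<le> M * (Gamma g * lam powr (- g) * exp (lam * t))"
proof (cases "set_integrable lborel {0<..<t} (\<lambda>s. (t - s) powr (g - 1) * f s)")
  case True
  note k = exp_kernel_integral_le[OF assms(1,2), of t]
  have "\<bar>LBINT s:{0<..<t}. (t - s) powr (g - 1) * f s\<bar>
      \<le> (LBINT s:{0<..<t}. M * ((t - s) powr (g - 1) * exp (lam * s)))"
    unfolding set_lebesgue_integral_def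
  proof (rule integral_abs_bound_integral)
    show "integrable lborel (\<lambda>s. indicator {0<..<t} s *\<^sub>R ((t - s) powr (g - 1) * f s))"
      using True by (simp add: set_integrable_def)
    show "integrable lborel
        (\<lambda>s. indicator {0<..<t} s *\<^sub>R (M * ((t - s) powr (g - 1) * exp (lam * s))))"
      using set_integrable_mult_right[of M, OF k(1)] by (simp add: set_integrable_def)
    show "\<bar>indicator {0<..<t} s *\<^sub>R ((t - s) powr (g - 1) * f s)\<bar> \<le>
        indicator {0<..<t} s *\<^sub>R (M * ((t - s) powr (g - 1) * exp (lam * s)))" for s
      using mult_left_mono[OF assms(4), of s "(t - s) powr (g - 1)"]
      by (auto simp: indicator_def abs_mult mult_ac)
  qed
  also have "\<dots> = M * (LBINT s:{0<..<t}. (t - s) powr (g - 1) * exp (lam * s))"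
    by simp
  also have "\<dots> \<le> M * (Gamma g * lam powr (- g) * exp (lam * t))"
    using assms k(2) by (intro mult_left_mono)
  finally show ?thesis .
next
  \<comment> \<open>A non-integrable function has the default integral 0, and the bound is
    nonnegative.\<close>
  case False
  then have "(LBINT s:{0<..<t}. (t - s) powr (g - 1) * f s) = 0"
    by (simp add: set_integrable_def set_lebesgue_integral_def not_integrable_integral_eq)
  then show ?thesis
    using assms Gamma_real_pos[of g] by simp
qed

text \<open>
  In the weighted norm \<open>sup exp (- lam * t) * \<bar>w t\<bar>\<close> the Volterra operator is a contraction
  once \<open>lam\<close> is large.
\<close>

lemma volterra_unique:
  fixes w :: "nat \<Rightarrow> real \<Rightarrow> real" and B :: "nat \<Rightarrow> nat \<Rightarrow> real" and g :: "nat \<Rightarrow> real"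
  assumes g: "\<And>i. i < m \<Longrightarrow> 0 < g i"
    and cont: "\<And>i. i < m \<Longrightarrow> continuous_on {0..} (w i)"
    and zero: "\<And>i. i < m \<Longrightarrow> w i 0 = 0"
    and eq: "\<And>i t. i < m \<Longrightarrow> 0 < t \<Longrightarrow>
      (LBINT s:{0<..<t}. (t - s) powr (g i - 1) * (\<Sum>l<m. B i l * w l s)) = Gamma (g i) * w i t"
    and "i < m" "0 \<le> T"
  shows "w i T = 0"
proof -
  define C where "C i = (\<Sum>l<m. \<bar>B i l\<bar>)" for i
  define W where "W t = (\<Sum>l<m. \<bar>w l t\<bar>)" for t
  have C_nonneg: "0 \<le> C i" for i
    by (auto simp: C_def intro: sum_nonneg)
  have w_le: "\<bar>w l t\<bar> \<le> W t" if "l < m" for l t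
    unfolding W_def using that by (intro member_le_sum) auto
  \<comment> \<open>Every exponent \<open>- g i\<close> is negative, so the sum tends to 0. Any
    contraction factor below 1 would do in place of \<open>1/2\<close>.\<close>
  have "((\<lambda>lam. \<Sum>i<m. C i * lam powr (- g i)) \<longlongrightarrow> (\<Sum>i<m. C i * 0)) at_top"
    using g by (intro tendsto_sum tendsto_mult tendsto_const tendsto_neg_powr filterlim_ident) auto
  then have "\<forall>\<^sub>F lam in at_top. (\<Sum>i<m. C i * lam powr (- g i)) < 1/2"
    by (intro order_tendstoD(2)[where y = 0]) simp_all
  then have "\<forall>\<^sub>F lam in at_top. (\<Sum>i<m. C i * lam powr (- g i)) < 1/2 \<and> 0 < lam"
    using eventually_gt_at_top eventually_conj by blast
  then obtain lam where lam: "(\<Sum>i<m. C i * lam powr (- g i)) < 1/2" "0 < lam"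
    using eventually_happens'[OF trivial_limit_at_top_linorder] by blast
  have "continuous_on {0..T} (\<lambda>t. exp (- lam * t) * W t)"
    unfolding W_def by (intro continuous_intros continuous_on_subset[OF cont]) auto
  \<comment> \<open>The weighted supremum over \<open>{0..T}\<close> is attained, so it suffices to
    estimate the equation at this single point.\<close>
  then obtain t where t: "t \<in> {0..T}"
    and sup: "\<And>s. s \<in> {0..T} \<Longrightarrow> exp (- lam * s) * W s \<le> exp (- lam * t) * W t"
    using continuous_attains_sup[of "{0..T}" "\<lambda>t. exp (- lam * t) * W t"] \<open>0 \<le> T\<close> by auto
  define M where "M = exp (- lam * t) * W t"
  have M_nonneg: "0 \<le> M"
    by (auto simp: M_def W_def intro: sum_nonneg)
  have W_le: "W s \<le> M * exp (lam * s)" if "s \<in> {0..T}" for s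
    using sup[OF that] unfolding M_def[symmetric] by (simp add: exp_minus field_simps)
  have "\<bar>w i t\<bar> \<le> C i * lam powr (- g i) * (M * exp (lam * t))" if i: "i < m" for i
  \<comment> \<open>The equation is given for positive times only; at 0 the initial value takes its
    place.\<close>
  proof (cases "t = 0")
    case True
    then show ?thesis
      using zero i C_nonneg M_nonneg by simp
  next
    case False
    have "\<bar>\<Sum>l<m. B i l * w l s\<bar> \<le> C i * M * exp (lam * s)" if s: "s \<in> {0<..<t}" for s
    proof -
      have "\<bar>\<Sum>l<m. B i l * w l s\<bar> \<le> (\<Sum>l<m. \<bar>B i l\<bar> * W s)"
        by (intro order_trans[OF sum_abs] sum_mono) (auto simp: abs_mult intro!: mult_left_mono w_le)
      also have "\<dots> = C i * W s"
        by (simp add: C_def sum_distrib_right)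
      also have "\<dots> \<le> C i * (M * exp (lam * s))"
        using s t by (intro mult_left_mono W_le C_nonneg) auto
      finally show ?thesis by simp
    qed
    then have "\<bar>Gamma (g i) * w i t\<bar> \<le> C i * M * (Gamma (g i) * lam powr (- g i) * exp (lam * t))"
      using eq[of i t] False t i g C_nonneg M_nonneg lam
        kernel_integral_bound[of lam "g i" "C i * M" t "\<lambda>s. \<Sum>l<m. B i l * w l s"]
      by auto
    then have "Gamma (g i) * \<bar>w i t\<bar> \<le> Gamma (g i) * (C i * lam powr (- g i) * (M * exp (lam * t)))"
      using Gamma_real_pos[of "g i"] g[OF i] by (simp add: abs_mult mult_ac)
    then show ?thesis
      using Gamma_real_pos[of "g i"] g[OF i] by simp
  qed
  then have "W t \<le> (\<Sum>i<m. C i * lam powr (- g i) * (M * exp (lam * t)))"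
    unfolding W_def by (intro sum_mono) auto
  also have "\<dots> = (\<Sum>i<m. C i * lam powr (- g i)) * (M * exp (lam * t))"
    by (simp add: sum_distrib_right)
  also have "\<dots> \<le> 1/2 * (M * exp (lam * t))"
    using lam M_nonneg by (intro mult_right_mono) auto
  finally have "M \<le> 1/2 * M"
    by (simp add: M_def exp_minus field_simps)
  then have "M = 0"
    using M_nonneg by simp
  then have "W T \<le> 0"
    using W_le[of T] \<open>0 \<le> T\<close> by simp
  then show ?thesis
    using w_le[OF \<open>i < m\<close>, of T] by simp
qed

section \<open>Fractional power series\<close>

text \<open>
  Assumption \<open>transfer\<close> is the block recursion in its most usable form: the pairs of coefficient and
  exponent in row \<open>i\<close> of generation \<open>n + 1\<close> are, up to zero coefficients, those of generation \<open>n\<close>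
  with the coefficients multiplied by \<open>B\<close> and the exponents raised by \<open>g i\<close>.
\<close>

locale frac_series =
  fixes m :: nat and B :: "nat \<Rightarrow> nat \<Rightarrow> real" and g :: "nat \<Rightarrow> real"
    and a :: "nat \<Rightarrow> nat \<Rightarrow> nat \<Rightarrow> real" and ex :: "nat \<Rightarrow> nat \<Rightarrow> real" and d :: real
  assumes d_pos: "0 < d"
    and g_pos: "\<And>i. i < m \<Longrightarrow> 0 < g i" and g_le_1: "\<And>i. i < m \<Longrightarrow> g i \<le> 1"
    and ex_0: "ex 0 0 = 0"
    and ex_ge: "\<And>n j. j \<le> n \<Longrightarrow> real n * d \<le> ex n j"
    and ex_le: "\<And>n j. j \<le> n \<Longrightarrow> ex n j \<le> real n"
    and transfer: "\<And>F n i. (\<And>x. F 0 x = 0) \<Longrightarrow> i < m \<Longrightarrow>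
      (\<Sum>j\<le>Suc n. F (a (Suc n) j i) (ex (Suc n) j)) =
      (\<Sum>j\<le>n. F (\<Sum>l<m. B i l * a n j l) (ex n j + g i) :: real)"
begin

definition b :: "nat \<Rightarrow> nat \<Rightarrow> nat \<Rightarrow> real" where
  "b n j i = (\<Sum>l<m. B i l * a n j l)"

text \<open>A common bound for all absolute row sums of \<open>B\<close>; the summand 1 keeps it
  positive and makes \<open>lam\<close> at least 1.\<close>

definition C :: real where "C = 1 + (\<Sum>i<m. \<Sum>l<m. \<bar>B i l\<bar>)"

definition K :: real where "K = (\<Sum>l<m. \<bar>a 0 0 l\<bar>)"

text \<open>With this exponential rate the \<open>n\<close>-th term of the series is of size \<open>4\<close> to the \<open>- n\<close>.\<close>

definition lam :: real where "lam = (4 * C) powr (1 / d)"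

text \<open>The case \<open>n = 0\<close> mirrors the one in \<open>p_mat\<close>: at
  \<open>t = 0\<close> the general formula would give \<open>0 powr 0 = 0\<close> and lose the
  initial value.\<close>

definition T :: "nat \<Rightarrow> nat \<Rightarrow> real \<Rightarrow> real" where
  "T n i t = (if n = 0 then a 0 0 i
    else \<Sum>j\<le>n. a n j i * (t powr ex n j / Gamma (1 + ex n j)))"

definition y :: "nat \<Rightarrow> real \<Rightarrow> real" where
  "y i t = (\<Sum>n. T n i t)"

text \<open>The derivative of \<open>T (Suc n) i\<close>. It is written with the exponents of
  generation \<open>n\<close> because the Caputo integral of order \<open>g i\<close> sends the
  exponent \<open>ex n j + g i - 1\<close> to \<open>ex n j\<close>.\<close>

definition D :: "nat \<Rightarrow> nat \<Rightarrow> real \<Rightarrow> real" where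
  "D n i t = (\<Sum>j\<le>n. b n j i * (t powr (ex n j + g i - 1) / Gamma (ex n j + g i)))"

section \<open>Geometric bounds for the coefficients and the terms\<close>

lemma C_ge_1: "1 \<le> C"
  by (auto simp: C_def intro!: sum_nonneg)

lemma row_sum_le_C: "i < m \<Longrightarrow> (\<Sum>l<m. \<bar>B i l\<bar>) \<le> C"
  using member_le_sum[of i "{..<m}" "\<lambda>i. \<Sum>l<m. \<bar>B i l\<bar>"]
  by (auto simp: C_def sum_nonneg)

lemma K_nonneg: "0 \<le> K"
  by (auto simp: K_def intro: sum_nonneg)

lemma lam_ge_1: "1 \<le> lam"
  using C_ge_1 d_pos by (auto simp: lam_def intro: ge_one_powr_ge_zero)

text \<open>A generation costs at most a factor \<open>C\<close> in the coefficients and gains this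
  factor through the lower bound \<open>real n * d\<close> on the exponents, which leaves the ratio
  \<open>1/4\<close>.\<close>

lemma lam_powr: "lam powr (- d) = 1 / (4 * C)"
  using C_ge_1 d_pos by (simp add: lam_def powr_powr powr_minus divide_simps)

lemma ex_nonneg: "j \<le> n \<Longrightarrow> 0 \<le> ex n j"
  using ex_ge[of j n] d_pos mult_nonneg_nonneg[of "real n" d] by linarith

lemma ex_pos: "j \<le> n \<Longrightarrow> 0 < n \<Longrightarrow> 0 < ex n j"
  using ex_ge[of j n] d_pos mult_pos_pos[of "real n" d] by linarith

lemma transfer_b:
  assumes "\<And>x. F 0 x = 0" "i < m"
  shows "(\<Sum>j\<le>Suc n. F (a (Suc n) j i) (ex (Suc n) j)) = (\<Sum>j\<le>n. F (b n j i) (ex n j + g i) :: real)"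
  unfolding b_def using assms by (rule transfer)

lemma abs_b_le: "\<bar>b n j i\<bar> \<le> (\<Sum>l<m. \<bar>B i l\<bar> * \<bar>a n j l\<bar>)"
  unfolding b_def by (rule order_trans[OF sum_abs]) (simp add: abs_mult)

text \<open>Exchanging the two sums reduces \<open>b\<close> to the row sums of \<open>B\<close>.
  The weights \<open>p\<close> allow two uses: constant 1 for the growth of the coefficients, and
  powers of \<open>t\<close> for the majorant of the Caputo integrals.\<close>

lemma sum_abs_b_le:
  assumes "i < m" and "\<And>j. j \<le> n \<Longrightarrow> 0 \<le> p j" and "0 \<le> M"
    and "\<And>l. l < m \<Longrightarrow> (\<Sum>j\<le>n. \<bar>a n j l\<bar> * p j) \<le> M"
  shows "(\<Sum>j\<le>n. \<bar>b n j i\<bar> * p j) \<le> C * M"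
proof -
  have "(\<Sum>j\<le>n. \<bar>b n j i\<bar> * p j) \<le> (\<Sum>j\<le>n. (\<Sum>l<m. \<bar>B i l\<bar> * \<bar>a n j l\<bar>) * p j)"
    using assms by (intro sum_mono mult_right_mono abs_b_le) auto
  also have "\<dots> = (\<Sum>l<m. \<bar>B i l\<bar> * (\<Sum>j\<le>n. \<bar>a n j l\<bar> * p j))"
    by (simp only: sum_distrib_left sum_distrib_right mult.assoc) (rule sum.swap)
  also have "\<dots> \<le> (\<Sum>l<m. \<bar>B i l\<bar> * M)"
    using assms by (intro sum_mono mult_left_mono) auto
  also have "\<dots> = (\<Sum>l<m. \<bar>B i l\<bar>) * M"
    by (simp add: sum_distrib_right)
  also have "\<dots> \<le> C * M"
    using assms by (intro mult_right_mono row_sum_le_C)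
  finally show ?thesis .
qed

text \<open>Induction over the generations, with \<open>transfer_b\<close> applied to the absolute
  value of the coefficient; each step costs one factor \<open>C\<close>.\<close>

lemma sum_abs_a_le: "i < m \<Longrightarrow> (\<Sum>j\<le>n. \<bar>a n j i\<bar>) \<le> K * C ^ n"
proof (induction n arbitrary: i)
  case 0
  then show ?case
    using member_le_sum[of i "{..<m}" "\<lambda>l. \<bar>a 0 0 l\<bar>"] by (auto simp: K_def)
next
  case (Suc n)
  have "(\<Sum>j\<le>Suc n. \<bar>a (Suc n) j i\<bar>) = (\<Sum>j\<le>n. \<bar>b n j i\<bar>)"
    using transfer_b[of "\<lambda>c x. \<bar>c\<bar>" i n] Suc.prems by simp
  also have "\<dots> \<le> C * (K * C ^ n)"
    using sum_abs_b_le[of i n "\<lambda>_. 1" "K * C ^ n"] Suc K_nonneg C_ge_1 by simp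
  finally show ?case
    by (simp add: mult_ac)
qed

text \<open>Since \<open>lam\<close> is at least 1, the exponent \<open>ex n j\<close> may be
  replaced by its lower bound \<open>real n * d\<close>.\<close>

lemma powr_ex_le:
  assumes "j \<le> n" "0 < t"
  shows "t powr ex n j / Gamma (1 + ex n j) \<le> (1 / (4 * C)) ^ n * exp (lam * t)"
proof -
  have "t powr ex n j / Gamma (1 + ex n j) \<le> lam powr (- ex n j) * exp (lam * t)"
    using powr_div_Gamma_le[of t lam "ex n j"] lam_ge_1 assms ex_nonneg by simp
  also have "\<dots> \<le> lam powr (real n * (- d)) * exp (lam * t)"
    using lam_ge_1 ex_ge[OF assms(1)] by (intro mult_right_mono powr_mono) auto
  also have "lam powr (real n * (- d)) = (lam powr (- d)) ^ n"
    using lam_ge_1 by (subst powr_power) auto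
  finally show ?thesis
    by (simp add: lam_powr)
qed

lemma powr_div_Gamma_nonneg: "j \<le> n \<Longrightarrow> 0 \<le> t powr ex n j / Gamma (1 + ex n j)"
  using ex_nonneg[of j n] Gamma_real_pos[of "1 + ex n j"] by simp

text \<open>The factors \<open>C ^ n\<close> cancel. Absolute values are summed because the later
  exchange of sum and integral requires absolute bounds.\<close>

lemma majorant_le:
  assumes "i < m" "0 < t"
  shows "(\<Sum>j\<le>n. \<bar>a n j i\<bar> * (t powr ex n j / Gamma (1 + ex n j))) \<le> K * (1/4) ^ n * exp (lam * t)"
proof -
  have "(\<Sum>j\<le>n. \<bar>a n j i\<bar> * (t powr ex n j / Gamma (1 + ex n j)))
      \<le> (\<Sum>j\<le>n. \<bar>a n j i\<bar> * ((1 / (4 * C)) ^ n * exp (lam * t)))"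
    using assms by (intro sum_mono mult_left_mono powr_ex_le) auto
  also have "\<dots> = (\<Sum>j\<le>n. \<bar>a n j i\<bar>) * ((1 / (4 * C)) ^ n * exp (lam * t))"
    by (simp add: sum_distrib_right)
  also have "\<dots> \<le> K * C ^ n * ((1 / (4 * C)) ^ n * exp (lam * t))"
    using C_ge_1 assms by (intro mult_right_mono sum_abs_a_le) auto
  also have "C ^ n * (1 / (4 * C)) ^ n = (1/4) ^ n"
    using C_ge_1 by (simp flip: power_mult_distrib)
  then have "K * C ^ n * ((1 / (4 * C)) ^ n * exp (lam * t)) = K * (1/4) ^ n * exp (lam * t)"
    by (metis (no_types, opaque_lifting) mult.assoc)
  finally show ?thesis .
qed

section \<open>Convergence and continuity of the series\<close>

lemma T_pos_arg: "0 < t \<Longrightarrow> T n i t = (\<Sum>j\<le>n. a n j i * (t powr ex n j / Gamma (1 + ex n j)))"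
  by (auto simp: T_def ex_0)

lemma T_0: "T n i 0 = (if n = 0 then a 0 0 i else 0)"
  by (auto simp: T_def)

lemma abs_T_le:
  assumes "i < m" "0 \<le> t"
  shows "\<bar>T n i t\<bar> \<le> K * (1/4) ^ n * exp (lam * t)"
proof (cases "t = 0")
  case True
  then show ?thesis
    using sum_abs_a_le[OF assms(1), of 0] K_nonneg by (auto simp: T_0)
next
  case False
  then have "T n i t = (\<Sum>j\<le>n. a n j i * (t powr ex n j / Gamma (1 + ex n j)))"
    using assms by (intro T_pos_arg) simp
  also have "\<bar>\<dots>\<bar> \<le> (\<Sum>j\<le>n. \<bar>a n j i * (t powr ex n j / Gamma (1 + ex n j))\<bar>)"
    by (rule sum_abs)
  also have "\<dots> = (\<Sum>j\<le>n. \<bar>a n j i\<bar> * (t powr ex n j / Gamma (1 + ex n j)))"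
    using powr_div_Gamma_nonneg by (intro sum.cong) (simp_all only: abs_mult abs_of_nonneg atMost_iff)
  finally show ?thesis
    using majorant_le[of i t n] assms False by simp
qed

lemma summable_T:
  assumes "i < m" "0 \<le> t"
  shows "summable (\<lambda>n. T n i t)"
proof (rule summable_comparison_test')
  show "summable (\<lambda>n. K * (1/4) ^ n * exp (lam * t))"
    by (intro summable_mult2 summable_mult summable_geometric) simp
  show "norm (T n i t) \<le> K * (1/4) ^ n * exp (lam * t)" for n
    using abs_T_le[OF assms] by simp
qed

lemma y_0: "y i 0 = a 0 0 i"
proof -
  have "(\<lambda>n. T n i 0) sums a 0 0 i"
    using sums_single[of 0 "\<lambda>_. a 0 0 i"] by (simp add: T_0[abs_def])
  then show ?thesis
    by (simp add: y_def sums_iff)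
qed

lemma continuous_on_T: "continuous_on {0..R} (T n i)"
proof (cases "n = 0")
  case False
  have "Gamma (1 + ex n j) \<noteq> 0" if "j \<le> n" for j
  proof -
    have "0 < 1 + ex n j"
      using ex_nonneg[OF that] by simp
    then show ?thesis
      by (metis Gamma_real_pos less_irrefl)
  qed
  then show ?thesis
    unfolding T_def[abs_def] using False ex_pos
    by (auto intro!: continuous_on_sum continuous_on_mult continuous_on_divide
        continuous_on_powr' continuous_on_id continuous_on_const)
qed (simp add: T_def[abs_def])

text \<open>The exponential majorant is uniform only on bounded intervals, so the Weierstrass test
  runs on each \<open>{0..R}\<close>; continuity at \<open>x\<close> is then read off from
  \<open>{0..x + 1}\<close>.\<close>

lemma continuous_on_y:
  assumes "i < m"
  shows "continuous_on {0..} (y i)"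
proof -
  have "continuous_on {0..R} (y i)" for R
  proof -
    have "uniform_limit {0..R} (\<lambda>n t. \<Sum>k<n. T k i t) (\<lambda>t. \<Sum>k. T k i t) sequentially"
    proof (rule Weierstrass_m_test)
      show "summable (\<lambda>n. K * (1/4) ^ n * exp (lam * R))"
        by (intro summable_mult2 summable_mult summable_geometric) simp
      show "norm (T n i t) \<le> K * (1/4) ^ n * exp (lam * R)" if "t \<in> {0..R}" for n t
      proof -
        have "\<bar>T n i t\<bar> \<le> K * (1/4) ^ n * exp (lam * t)"
          using that assms by (intro abs_T_le) auto
        also have "\<dots> \<le> K * (1/4) ^ n * exp (lam * R)"
          using that lam_ge_1 K_nonneg by (intro mult_left_mono) auto
        finally show ?thesis by simp
      qed
    qed
    then show ?thesis
      unfolding y_def[abs_def]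
      by (rule uniform_limit_theorem[rotated])
        (auto intro!: always_eventually continuous_on_sum continuous_on_T)
  qed
  then have "continuous (at x within {0..x + 1}) (y i)" if "0 \<le> x" for x
    using that by (simp add: continuous_on_eq_continuous_within)
  moreover have "at x within {0..x + 1} = at x within {0..}" for x :: real
    by (rule at_within_nhd[of x "{..<x + 1}"]) auto
  ultimately show ?thesis
    by (simp add: continuous_on_eq_continuous_within)
qed

section \<open>Termwise differentiation\<close>

lemma summable_index_quarter: "summable (\<lambda>n. real (Suc n) * (1/4) ^ Suc n)"
proof (rule summable_comparison_test')
  show "summable (\<lambda>n. (1/2 :: real) ^ Suc n)"
    by (subst summable_Suc_iff) (intro summable_geometric, simp)
  \<comment> \<open>The linear factor is absorbed by a power of 2, which weakens the ratio from
    \<open>1/4\<close> to \<open>1/2\<close>.\<close>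
  have "real (Suc n) * (1/4) ^ Suc n \<le> 2 ^ Suc n * (1/4) ^ Suc n" for n
    using of_nat_less_two_power[of "Suc n", where 'a = real] by (intro mult_right_mono) auto
  then show "norm (real (Suc n) * (1/4 :: real) ^ Suc n) \<le> (1/2) ^ Suc n" for n
    by (simp flip: power_mult_distrib del: power_Suc)
qed

lemma T_Suc:
  "i < m \<Longrightarrow> T (Suc n) i t =
    (\<Sum>j\<le>n. b n j i * (t powr (ex n j + g i) / Gamma (1 + (ex n j + g i))))"
  using transfer_b[of "\<lambda>c x. c * (t powr x / Gamma (1 + x))" i n] by (simp add: T_def)

lemma ex_g_pos: "j \<le> n \<Longrightarrow> i < m \<Longrightarrow> 0 < ex n j + g i"
  using ex_nonneg[of j n] g_pos[of i] by simp

lemma T_Suc_deriv: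
  assumes "i < m" "0 < t"
  shows "(T (Suc n) i has_field_derivative D n i t) (at t)"
proof -
  have "((\<lambda>t. \<Sum>j\<le>n. b n j i * (t powr (ex n j + g i) / Gamma (1 + (ex n j + g i))))
      has_field_derivative D n i t) (at t)"
    unfolding D_def using assms ex_g_pos
    by (intro DERIV_sum DERIV_cmult powr_div_Gamma_deriv) auto
  then show ?thesis
    by (simp add: T_Suc[OF assms(1), abs_def])
qed

text \<open>Differentiation multiplies a power by its exponent over \<open>t\<close>. After
  \<open>transfer_b\<close> the exponents belong to generation \<open>Suc n\<close> and are at most
  \<open>Suc n\<close> by \<open>ex_le\<close>, so only this factor and \<open>1/t\<close> are lost
  against \<open>majorant_le\<close>.\<close>

lemma D_majorant_le:
  assumes "i < m" "0 < t"
  shows "\<bar>D n i t\<bar> \<le> real (Suc n) * (1/4) ^ Suc n * (K * exp (lam * t) / t)"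
proof -
  let ?h = "\<lambda>x. x * (t powr x / Gamma (1 + x)) / t"
  have h: "t powr (x - 1) / Gamma x = ?h x" if "0 < x" for x
  proof -
    have "x \<notin> \<int>\<^sub>\<le>\<^sub>0"
      using that by (auto elim!: nonpos_Ints_cases)
    then have "Gamma (1 + x) = x * Gamma x"
      using Gamma_plus1[of x] by (simp add: add.commute)
    then show ?thesis
      using that assms by (simp add: powr_diff)
  qed
  have "\<bar>D n i t\<bar> \<le> (\<Sum>j\<le>n. \<bar>b n j i\<bar> * ?h (ex n j + g i))"
    unfolding D_def
  proof (intro order_trans[OF sum_abs] sum_mono)
    fix j assume "j \<in> {..n}"
    then have "0 < ex n j + g i"
      using ex_g_pos assms by simp
    then show "\<bar>b n j i * (t powr (ex n j + g i - 1) / Gamma (ex n j + g i))\<bar>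
        \<le> \<bar>b n j i\<bar> * ?h (ex n j + g i)"
      using Gamma_real_pos[of "ex n j + g i"] by (subst h[symmetric]) (auto simp: abs_mult)
  qed
  also have "\<dots> = (\<Sum>j\<le>Suc n. \<bar>a (Suc n) j i\<bar> * ?h (ex (Suc n) j))"
    using transfer_b[of "\<lambda>c x. \<bar>c\<bar> * ?h x" i n] assms by simp
  also have "\<dots> \<le> (\<Sum>j\<le>Suc n. real (Suc n) / t *
      (\<bar>a (Suc n) j i\<bar> * (t powr ex (Suc n) j / Gamma (1 + ex (Suc n) j))))"
  proof (rule sum_mono)
    fix j assume "j \<in> {..Suc n}"
    then have j: "j \<le> Suc n" by simp
    have "ex (Suc n) j * (\<bar>a (Suc n) j i\<bar> * (t powr ex (Suc n) j / Gamma (1 + ex (Suc n) j)) / t)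
      \<le> real (Suc n) * (\<bar>a (Suc n) j i\<bar> * (t powr ex (Suc n) j / Gamma (1 + ex (Suc n) j)) / t)"
      using assms powr_div_Gamma_nonneg[OF j, of t]
      by (intro mult_right_mono[OF ex_le[OF j]] divide_nonneg_nonneg[OF mult_nonneg_nonneg]) auto
    then show "\<bar>a (Suc n) j i\<bar> * ?h (ex (Suc n) j) \<le> real (Suc n) / t *
        (\<bar>a (Suc n) j i\<bar> * (t powr ex (Suc n) j / Gamma (1 + ex (Suc n) j)))"
      by (simp add: mult_ac)
  qed
  also have "\<dots> = real (Suc n) / t *
      (\<Sum>j\<le>Suc n. \<bar>a (Suc n) j i\<bar> * (t powr ex (Suc n) j / Gamma (1 + ex (Suc n) j)))"
    by (simp only: sum_distrib_left)
  also have "\<dots> \<le> real (Suc n) / t * (K * (1/4) ^ Suc n * exp (lam * t))"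
    using assms by (intro mult_left_mono majorant_le) auto
  finally show ?thesis
    by (simp add: mult_ac)
qed

lemma summable_abs_D:
  assumes "i < m" "0 < t"
  shows "summable (\<lambda>n. \<bar>D n i t\<bar>)"
proof (rule summable_comparison_test')
  show "summable (\<lambda>n. real (Suc n) * (1/4) ^ Suc n * (K * exp (lam * t) / t))"
    by (intro summable_mult2 summable_index_quarter)
  show "norm \<bar>D n i t\<bar> \<le> real (Suc n) * (1/4) ^ Suc n * (K * exp (lam * t) / t)" for n
    using D_majorant_le[OF assms, of n] by simp
qed

text \<open>The bound on \<open>D\<close> degenerates at 0 through the factor \<open>1/t\<close>, so
  the Weierstrass test uses a compact neighbourhood of \<open>t\<close> inside the positive axis.
  The constant term of generation 0 is split off, since \<open>D\<close> starts with the derivative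
  of generation 1.\<close>

lemma y_deriv:
  assumes "i < m" "0 < t"
  shows "(y i has_field_derivative (\<Sum>n. D n i t)) (at t)"
proof -
  let ?S = "{t/2..2*t}"
  have "uniformly_convergent_on ?S (\<lambda>n s. \<Sum>k<n. D k i s)"
  proof (rule Weierstrass_m_test')
    show "summable (\<lambda>n. real (Suc n) * (1/4) ^ Suc n * (K * exp (lam * (2 * t)) / (t / 2)))"
      by (intro summable_mult2 summable_index_quarter)
    fix n s assume s: "s \<in> ?S"
    have "\<bar>D n i s\<bar> \<le> real (Suc n) * (1/4) ^ Suc n * (K * exp (lam * s) / s)"
      using s assms by (intro D_majorant_le) auto
    also have "\<dots> \<le> real (Suc n) * (1/4) ^ Suc n * (K * exp (lam * (2 * t)) / (t / 2))"
      using s assms lam_ge_1 K_nonneg by (intro mult_left_mono frac_le) auto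
    finally show "norm (D n i s) \<le> real (Suc n) * (1/4) ^ Suc n * (K * exp (lam * (2 * t)) / (t / 2))"
      by simp
  qed
  moreover have "summable (\<lambda>n. T (Suc n) i t)"
    using summable_T[of i t] assms summable_Suc_iff[of "\<lambda>n. T n i t"] by simp
  moreover have "t \<in> interior ?S"
    using assms by simp
  ultimately have "((\<lambda>s. \<Sum>n. T (Suc n) i s) has_field_derivative (\<Sum>n. D n i t)) (at t)"
    using assms
    by (intro has_field_derivative_series'[where S = ?S and x0 = t])
      (auto intro!: has_field_derivative_at_within[OF T_Suc_deriv])
  then have "((\<lambda>s. a 0 0 i + (\<Sum>n. T (Suc n) i s)) has_field_derivative (\<Sum>n. D n i t)) (at t)"
    by (auto intro!: derivative_eq_intros)
  moreover have "\<forall>\<^sub>F s in nhds t. a 0 0 i + (\<Sum>n. T (Suc n) i s) = y i s"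
  proof -
    have "\<forall>\<^sub>F s in nhds t. 0 < s"
      using assms by (simp add: eventually_nhds_in_open[of "{0<..}", simplified])
    then show ?thesis
    proof eventually_elim
      case (elim s)
      then show ?case
        using suminf_split_head[OF summable_T[of i s]] assms by (simp add: y_def T_def)
    qed
  qed
  ultimately show ?thesis
    by (subst (asm) DERIV_cong_ev) auto
qed

section \<open>Termwise Caputo differentiation\<close>

lemma B_T:
  assumes "0 < t"
  shows "(\<Sum>l<m. B i l * T n l t) = (\<Sum>j\<le>n. b n j i * (t powr ex n j / Gamma (1 + ex n j)))"
  unfolding T_pos_arg[OF assms] b_def
  by (simp only: sum_distrib_left sum_distrib_right mult.assoc) (rule sum.swap)

lemma B_y:
  assumes "0 < t"
  shows "summable (\<lambda>n. \<Sum>l<m. B i l * T n l t)"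
    and "(\<Sum>n. \<Sum>l<m. B i l * T n l t) = (\<Sum>l<m. B i l * y l t)"
proof -
  have T: "summable (\<lambda>n. B i l * T n l t)" if "l < m" for l
    using summable_T[OF that, of t] assms by (intro summable_mult) simp
  then show "summable (\<lambda>n. \<Sum>l<m. B i l * T n l t)"
    by (intro summable_sum) simp
  show "(\<Sum>n. \<Sum>l<m. B i l * T n l t) = (\<Sum>l<m. B i l * y l t)"
    unfolding y_def using T assms
    by (subst suminf_sum) (auto intro!: sum.cong suminf_mult summable_T)
qed

text \<open>Each power leads to a Beta integral with parameters \<open>ex n j + g i\<close> and
  \<open>1 - g i\<close>, in which \<open>Gamma (ex n j + g i)\<close> cancels. The coefficients
  \<open>c\<close> are free: \<open>b\<close> gives the series, its absolute value the
  majorant.\<close>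

lemma kernel_sum_integral:
  assumes "i < m" "g i < 1" "0 < t"
  shows "has_bochner_integral lborel
    (\<lambda>s. indicator {0<..<t} s *
      ((\<Sum>j\<le>n. c j * (s powr (ex n j + g i - 1) / Gamma (ex n j + g i))) / (t - s) powr g i))
    (Gamma (1 - g i) * (\<Sum>j\<le>n. c j * (t powr ex n j / Gamma (1 + ex n j))))"
proof -
  let ?k = "\<lambda>j s. indicator {0<..<t} s * ((s - 0) powr (ex n j + g i - 1) * (t - s) powr (1 - g i - 1))"
  have "has_bochner_integral lborel (\<lambda>s. \<Sum>j\<le>n. c j / Gamma (ex n j + g i) * ?k j s)
    (\<Sum>j\<le>n. c j / Gamma (ex n j + g i) *
      ((t - 0) powr (ex n j + g i + (1 - g i) - 1) * Beta (ex n j + g i) (1 - g i)))"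
    using assms ex_g_pos
    by (intro has_bochner_integral_sum has_bochner_integral_mult_right
        has_bochner_integral_Beta_kernel) auto
  moreover have "(\<Sum>j\<le>n. c j / Gamma (ex n j + g i) * ?k j s) = indicator {0<..<t} s *
      ((\<Sum>j\<le>n. c j * (s powr (ex n j + g i - 1) / Gamma (ex n j + g i))) / (t - s) powr g i)" for s
    unfolding sum_distrib_left sum_divide_distrib
    by (intro sum.cong) (auto simp: powr_minus divide_simps)
  moreover have "(\<Sum>j\<le>n. c j / Gamma (ex n j + g i) *
      ((t - 0) powr (ex n j + g i + (1 - g i) - 1) * Beta (ex n j + g i) (1 - g i))) =
    Gamma (1 - g i) * (\<Sum>j\<le>n. c j * (t powr ex n j / Gamma (1 + ex n j)))"
    unfolding sum_distrib_left
  proof (rule sum.cong)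
    fix j assume "j \<in> {..n}"
    then have "Gamma (ex n j + g i) \<noteq> 0"
      using Gamma_real_pos[OF ex_g_pos[of j n i]] assms by (metis atMost_iff less_irrefl)
    then show "c j / Gamma (ex n j + g i) *
        ((t - 0) powr (ex n j + g i + (1 - g i) - 1) * Beta (ex n j + g i) (1 - g i)) =
      Gamma (1 - g i) * (c j * (t powr ex n j / Gamma (1 + ex n j)))"
      by (simp add: Beta_def add.commute)
  qed simp
  ultimately show ?thesis
    by simp
qed

lemma deriv_y: "i < m \<Longrightarrow> 0 < t \<Longrightarrow> deriv (y i) t = (\<Sum>n. D n i t)"
  using y_deriv by (rule DERIV_imp_deriv)

text \<open>Sum and integral may be exchanged because the integrals of the norms are summable.
  \<open>f n\<close> is the Caputo integrand of term \<open>Suc n\<close>, and \<open>F n\<close>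
  the same with absolute coefficients, whose integral is known exactly.\<close>

lemma caputo_y_less_1:
  assumes i: "i < m" and g: "g i < 1" and t: "0 < t"
  shows "caputo_differentiable (g i) (y i) t"
    and "caputo_deriv (g i) (y i) t = (\<Sum>l<m. B i l * y l t)"
proof -
  define f where "f n s = indicator {0<..<t} s * (D n i s / (t - s) powr g i)" for n s
  define F where "F n s = indicator {0<..<t} s *
      ((\<Sum>j\<le>n. \<bar>b n j i\<bar> * (s powr (ex n j + g i - 1) / Gamma (ex n j + g i))) / (t - s) powr g i)"
    for n s
  have f: "has_bochner_integral lborel (f n) (Gamma (1 - g i) * (\<Sum>l<m. B i l * T n l t))" for n
    unfolding f_def[abs_def] D_def B_T[OF t] using assms by (rule kernel_sum_integral)
  have F: "has_bochner_integral lborel (F n)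
      (Gamma (1 - g i) * (\<Sum>j\<le>n. \<bar>b n j i\<bar> * (t powr ex n j / Gamma (1 + ex n j))))" for n
    unfolding F_def[abs_def] using assms by (rule kernel_sum_integral)
  have G: "0 < Gamma (1 - g i)"
    using g by (intro Gamma_real_pos) simp
  have f_le_F: "norm (f n s) \<le> F n s" for n s
  proof -
    have "\<bar>D n i s\<bar> \<le> (\<Sum>j\<le>n. \<bar>b n j i\<bar> * (s powr (ex n j + g i - 1) / Gamma (ex n j + g i)))"
      unfolding D_def using Gamma_real_pos[OF ex_g_pos, OF _ i, of _ n]
      by (intro order_trans[OF sum_abs] sum_mono) (auto simp: abs_mult less_imp_le)
    then show ?thesis
      by (auto simp: f_def F_def indicator_def abs_mult intro!: divide_right_mono)
  qed
  have int_f: "integrable lborel (f n)" for n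
    using f by (simp add: has_bochner_integral_iff)
  have sum_f: "summable (\<lambda>n. norm (f n s))" for s
  proof (cases "s \<in> {0<..<t}")
    case True
    then show ?thesis
      using summable_divide[OF summable_abs_D[OF i, of s], of "(t - s) powr g i"]
      by (simp add: f_def abs_mult)
  qed (simp add: f_def)
  have sum_int_f: "summable (\<lambda>n. \<integral>s. norm (f n s) \<partial>lborel)"
  proof (rule summable_comparison_test')
    show "summable (\<lambda>n. Gamma (1 - g i) * (C * (K * (1/4) ^ n * exp (lam * t))))"
      by (intro summable_mult2 summable_mult summable_geometric) simp
    fix n
    have "(\<integral>s. norm (f n s) \<partial>lborel) \<le> integral\<^sup>L lborel (F n)"
      using F int_f f_le_F by (intro integral_mono) (auto simp: has_bochner_integral_iff)
    also have "\<dots> \<le> Gamma (1 - g i) * (C * (K * (1/4) ^ n * exp (lam * t)))"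
      unfolding has_bochner_integral_integral_eq[OF F]
      using G t i K_nonneg powr_div_Gamma_nonneg majorant_le
      by (intro mult_left_mono sum_abs_b_le) (simp_all only: less_imp_le zero_le_mult_iff, simp_all)
    finally show "norm (\<integral>s. norm (f n s) \<partial>lborel) \<le> Gamma (1 - g i) * (C * (K * (1/4) ^ n * exp (lam * t)))"
      by simp
  qed
  note exchange = int_f AE_I2[OF sum_f] sum_int_f
  have suminf_f: "(\<Sum>n. f n s) = indicator {0<..<t} s *\<^sub>R (deriv (y i) s / (t - s) powr g i)" for s
  proof (cases "s \<in> {0<..<t}")
    case True
    then have "summable (\<lambda>n. D n i s)"
      using summable_abs_D[OF i, of s] summable_rabs_cancel by simp
    then show ?thesis
      using True i by (simp add: f_def deriv_y suminf_divide)
  qed (simp add: f_def)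
  have "set_integrable lborel {0<..<t} (\<lambda>s. deriv (y i) s / (t - s) powr g i)"
    using integrable_suminf[OF exchange] by (simp add: suminf_f set_integrable_def)
  moreover have "y i differentiable (at s)" if "0 < s" for s
    using y_deriv[OF i that] by (auto simp: real_differentiable_def)
  ultimately show "caputo_differentiable (g i) (y i) t"
    using g by (auto simp: caputo_differentiable_def)
  have "(LBINT s:{0<..<t}. deriv (y i) s / (t - s) powr g i) = (\<Sum>n. integral\<^sup>L lborel (f n))"
    using integral_suminf[OF exchange] by (simp add: suminf_f set_lebesgue_integral_def)
  also have "\<dots> = (\<Sum>n. Gamma (1 - g i) * (\<Sum>l<m. B i l * T n l t))"
    using f by (simp add: has_bochner_integral_iff)
  also have "\<dots> = Gamma (1 - g i) * (\<Sum>l<m. B i l * y l t)"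
    using t by (simp add: B_y suminf_mult)
  finally show "caputo_deriv (g i) (y i) t = (\<Sum>l<m. B i l * y l t)"
    using g by (simp add: caputo_deriv_def less_imp_neq[OF G, symmetric])
qed

lemma caputo_y:
  assumes i: "i < m" and t: "0 < t"
  shows "caputo_differentiable (g i) (y i) t"
    and "caputo_deriv (g i) (y i) t = (\<Sum>l<m. B i l * y l t)"
proof -
  show "caputo_differentiable (g i) (y i) t"
  proof (cases "g i = 1")
    case True
    then show ?thesis
      using y_deriv[OF i t] by (auto simp: caputo_differentiable_def real_differentiable_def)
  next
    case False
    then show ?thesis
      using caputo_y_less_1[of i t] g_le_1[of i] i t by simp
  qed
  show "caputo_deriv (g i) (y i) t = (\<Sum>l<m. B i l * y l t)"
  proof (cases "g i = 1")
    case True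
    \<comment> \<open>For \<open>g i = 1\<close> the exponent \<open>ex n j + g i - 1\<close> is
      \<open>ex n j\<close> again, so the derivative of term \<open>Suc n\<close> is
      \<open>B\<close> applied to term \<open>n\<close>.\<close>
    have "D n i t = (\<Sum>l<m. B i l * T n l t)" for n
      using True t by (simp add: D_def B_T add.commute)
    then show ?thesis
      using True deriv_y[OF i t] B_y[OF t] by (simp add: caputo_deriv_def)
  next
    case False
    then show ?thesis
      using caputo_y_less_1[of i t] g_le_1[of i] i t by simp
  qed
qed

end

section \<open>The block recursion\<close>

lemma sum_blocks:
  fixes f :: "nat \<Rightarrow> 'a::comm_monoid_add"
  shows "(\<Sum>q<m * (n + 1). f q) = (\<Sum>j\<le>n. \<Sum>k<m. f (j * m + k))"
proof -
  have "(\<Sum>q<m * (n + 1). f q) = (\<Sum>j<Suc n. sum f {j * m..<j * m + m})"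
    by (simp add: sum.nat_group mult.commute del: sum.lessThan_Suc)
  also have "\<dots> = (\<Sum>j<Suc n. \<Sum>k<m. f (j * m + k))"
    by (subst sum.atLeastLessThan_shift_0) (simp add: atLeast0LessThan)
  finally show ?thesis
    by (simp only: lessThan_Suc_atMost)
qed

lemma mult_mat_vec_nth:
  assumes "M \<in> carrier_mat r c" "v \<in> carrier_vec c" "i < r"
  shows "(M *\<^sub>v v) $ i = (\<Sum>k<c. M $$ (i, k) * v $ k)"
  using assms by (auto simp: scalar_prod_def atLeast0LessThan intro!: sum.cong)

lemma mult_mat_nth:
  assumes "M \<in> carrier_mat r c" "N \<in> carrier_mat c d" "i < r" "k < d"
  shows "(M * N) $$ (i, k) = (\<Sum>l<c. M $$ (i, l) * N $$ (l, k))"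
  using assms by (auto simp: scalar_prod_def atLeast0LessThan intro!: sum.cong)

lemma block_less:
  fixes m :: nat
  assumes "j \<le> n" "k < m"
  shows "j * m + k < m * (n + 1)"
proof -
  have "j * m + k < (j + 1) * m"
    using assms by simp
  also have "\<dots> \<le> (n + 1) * m"
    using assms by (intro mult_right_mono) auto
  finally show ?thesis
    by (simp add: mult.commute)
qed

text \<open>\<open>coef m1 m2 A z n j\<close> is the \<open>j\<close>-th block of \<open>L_n\<close> applied to \<open>z\<close>.\<close>

definition coef ::
    "nat \<Rightarrow> nat \<Rightarrow> real Matrix.mat \<Rightarrow> real Matrix.vec \<Rightarrow> nat \<Rightarrow> nat \<Rightarrow> nat \<Rightarrow> real" where
  "coef m1 m2 A z n j i =
    (\<Sum>k<m1 + m2. L_mat m1 m2 A n $$ (i, j * (m1 + m2) + k) * z $ k)"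

text \<open>The exponent in entry \<open>j\<close> of \<open>p_n\<close>; the truncated difference
  is exact for \<open>j \<le> n\<close>.\<close>

definition expo :: "real \<Rightarrow> real \<Rightarrow> nat \<Rightarrow> nat \<Rightarrow> real" where
  "expo \<alpha> \<beta> n j = real (n - j) * \<alpha> + real j * \<beta>"

text \<open>The Kronecker factor \<open>1\<^sub>m m\<close> makes the product a stack of scaled
  copies of \<open>z\<close>, one per entry of \<open>p_n\<close>; only \<open>l = k\<close>
  survives in the row sum.\<close>

lemma p_mat_mult_vec:
  assumes "0 < n" "z \<in> carrier_vec m" "j \<le> n" "k < m"
  shows "(p_mat m \<alpha> \<beta> n t *\<^sub>v z) $ (j * m + k) =
    t powr expo \<alpha> \<beta> n j / Gamma (1 + expo \<alpha> \<beta> n j) * z $ k"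
proof -
  let ?P = "t powr expo \<alpha> \<beta> n j / Gamma (1 + expo \<alpha> \<beta> n j)"
  have "(p_mat m \<alpha> \<beta> n t *\<^sub>v z) $ (j * m + k) = (\<Sum>l<m. p_mat m \<alpha> \<beta> n t $$ (j * m + k, l) * z $ l)"
    by (rule mult_mat_vec_nth[OF p_mat_carrier assms(2) block_less[OF assms(3,4)]])
  also have "\<dots> = (\<Sum>l<m. if l = k then ?P * z $ l else 0)"
  proof (intro sum.cong refl)
    fix l assume "l \<in> {..<m}"
    moreover have "j * m + k < m + n * m"
      using block_less[OF assms(3,4)] by (simp add: mult.commute)
    moreover have "(j * m + k) div m = j" "(j * m + k) mod m = k"
      using assms by auto
    ultimately show "p_mat m \<alpha> \<beta> n t $$ (j * m + k, l) * z $ l = (if l = k then ?P * z $ l else 0)"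
      using assms by (auto simp: p_mat_def kronecker_def expo_def add.assoc)
  qed
  also have "\<dots> = ?P * z $ k"
    using assms by simp
  finally show ?thesis .
qed

lemma series_term_nth:
  assumes "A \<in> carrier_mat (m1 + m2) (m1 + m2)" "z \<in> carrier_vec (m1 + m2)"
    and "0 < n" "i < m1 + m2"
  shows "series_term m1 m2 \<alpha> \<beta> A z t n $ i =
    (\<Sum>j\<le>n. coef m1 m2 A z n j i * (t powr expo \<alpha> \<beta> n j / Gamma (1 + expo \<alpha> \<beta> n j)))"
proof -
  let ?m = "m1 + m2"
  have "series_term m1 m2 \<alpha> \<beta> A z t n = L_mat m1 m2 A n *\<^sub>v (p_mat ?m \<alpha> \<beta> n t *\<^sub>v z)"
    unfolding series_term_def
    by (rule assoc_mult_mat_vec[OF L_mat_carrier[OF assms(1)] p_mat_carrier assms(2)])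
  also have "\<dots> $ i = (\<Sum>q<?m * (n + 1). L_mat m1 m2 A n $$ (i, q) * (p_mat ?m \<alpha> \<beta> n t *\<^sub>v z) $ q)"
    using assms
    by (intro mult_mat_vec_nth[OF L_mat_carrier[OF assms(1)]] mult_mat_vec_carrier[OF p_mat_carrier])
  also have "\<dots> = (\<Sum>j\<le>n. \<Sum>k<?m. L_mat m1 m2 A n $$ (i, j * ?m + k) *
      (p_mat ?m \<alpha> \<beta> n t *\<^sub>v z) $ (j * ?m + k))"
    by (rule sum_blocks)
  also have "\<dots> = (\<Sum>j\<le>n. coef m1 m2 A z n j i *
      (t powr expo \<alpha> \<beta> n j / Gamma (1 + expo \<alpha> \<beta> n j)))"
    unfolding coef_def sum_distrib_right
    using assms by (intro sum.cong refl) (simp add: p_mat_mult_vec)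
  finally show ?thesis .
qed

lemma series_term_0:
  assumes "z \<in> carrier_vec (m1 + m2)"
  shows "series_term m1 m2 \<alpha> \<beta> A z t 0 = z"
  using assms by (simp add: series_term_def p_mat_def)

lemma coef_0:
  assumes "i < m1 + m2"
  shows "coef m1 m2 A z 0 0 i = z $ i"
proof -
  have "coef m1 m2 A z 0 0 i = (\<Sum>k<m1 + m2. if k = i then z $ k else 0)"
    unfolding coef_def using assms by (intro sum.cong) auto
  then show ?thesis
    using assms by simp
qed

text \<open>Left multiplication by \<open>A\<close> respects the division into column blocks, so it
  acts on each \<open>coef\<close> vector separately.\<close>

lemma mult_L_mat_block:
  assumes "A \<in> carrier_mat (m1 + m2) (m1 + m2)" "i < m1 + m2" "j \<le> n"
  shows "(\<Sum>k<m1 + m2. (A * L_mat m1 m2 A n) $$ (i, j * (m1 + m2) + k) * z $ k) =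
    (\<Sum>l<m1 + m2. A $$ (i, l) * coef m1 m2 A z n j l)"
proof -
  have "(\<Sum>k<m1 + m2. (A * L_mat m1 m2 A n) $$ (i, j * (m1 + m2) + k) * z $ k) =
    (\<Sum>k<m1 + m2. \<Sum>l<m1 + m2. A $$ (i, l) *
      (L_mat m1 m2 A n $$ (l, j * (m1 + m2) + k) * z $ k))"
  proof (intro sum.cong refl)
    fix k assume "k \<in> {..<m1 + m2}"
    then have "(A * L_mat m1 m2 A n) $$ (i, j * (m1 + m2) + k) =
        (\<Sum>l<m1 + m2. A $$ (i, l) * L_mat m1 m2 A n $$ (l, j * (m1 + m2) + k))"
      using assms(2,3)
      by (intro mult_mat_nth[OF assms(1) L_mat_carrier[OF assms(1)]] block_less) auto
    then show "(A * L_mat m1 m2 A n) $$ (i, j * (m1 + m2) + k) * z $ k =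
        (\<Sum>l<m1 + m2. A $$ (i, l) * (L_mat m1 m2 A n $$ (l, j * (m1 + m2) + k) * z $ k))"
      by (simp only: sum_distrib_right mult.assoc)
  qed
  also have "\<dots> = (\<Sum>l<m1 + m2. A $$ (i, l) * coef m1 m2 A z n j l)"
    unfolding coef_def sum_distrib_left by (rule sum.swap)
  finally show ?thesis .
qed

text \<open>Reads \<open>shift_blocks\<close> at the level of blocks: the upper rows keep their
  positions and gain a zero block at \<open>Suc n\<close>, the lower rows move one block to the
  right and leave a zero block at 0.\<close>

lemma coef_Suc:
  assumes A: "A \<in> carrier_mat (m1 + m2) (m1 + m2)" and i: "i < m1 + m2" and j: "j \<le> Suc n"
  shows "coef m1 m2 A z (Suc n) j i =
    (if i < m1 then (if j \<le> n then \<Sum>l<m1 + m2. A $$ (i, l) * coef m1 m2 A z n j l else 0)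
     else (if j = 0 then 0 else \<Sum>l<m1 + m2. A $$ (i, l) * coef m1 m2 A z n (j - 1) l))"
proof -
  let ?m = "m1 + m2" and ?M = "A * L_mat m1 m2 A n"
  have M: "?M \<in> carrier_mat ?m (?m * (n + 1))"
    using A L_mat_carrier[OF A] by (rule mult_carrier_mat)
  have L: "L_mat m1 m2 A (Suc n) $$ (i, j * ?m + k) =
    (if i < m1 then (if j \<le> n then ?M $$ (i, j * ?m + k) else 0)
     else (if j = 0 then 0 else ?M $$ (i, (j - 1) * ?m + k)))" if k: "k < ?m" for k
  proof -
    have 1: "j * ?m + k < ?m * (n + 1) + ?m"
      using block_less[OF j k] by simp
    \<comment> \<open>These facts turn the column tests and the column shift in
      \<open>shift_blocks\<close> into tests and a shift of the block number
      \<open>j\<close>.\<close>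
    have 2: "j * ?m + k < ?m * (n + 1) \<longleftrightarrow> j \<le> n"
    proof
      assume "j * ?m + k < ?m * (n + 1)"
      then have "j * ?m < (n + 1) * ?m"
        by (metis add_lessD1 mult.commute)
      then show "j \<le> n"
        by (metis Suc_eq_plus1 less_Suc_eq_le mult_less_cancel2)
    qed (rule block_less[OF _ k])
    have 3: "j * ?m + k < ?m \<longleftrightarrow> j = 0"
      using k by (cases j) auto
    have 4: "j * ?m + k - ?m = (j - 1) * ?m + k" if "j \<noteq> 0"
      using that by (cases j) auto
    show ?thesis
      unfolding L_mat.simps shift_blocks_def carrier_matD[OF M] index_mat(1)[OF i 1] prod.case 2 3
      by (cases "j = 0") (simp_all only: 4 simp_thms if_True if_False)
  qed
  show ?thesis
    unfolding coef_def[of m1 m2 A z "Suc n"]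
    using j mult_L_mat_block[OF A i, of j n z] mult_L_mat_block[OF A i, of "j - 1" n z]
    by (auto simp: L simp del: L_mat.simps index_mult_mat)
qed

text \<open>The zero block contributes nothing because \<open>F\<close> vanishes at coefficient 0.
  In the upper rows it is the last summand; in the lower rows it is the first, and the sum is
  re-indexed by one.\<close>

lemma coef_transfer:
  assumes A: "A \<in> carrier_mat (m1 + m2) (m1 + m2)" and i: "i < m1 + m2" and F: "\<And>x. F 0 x = 0"
  shows "(\<Sum>j\<le>Suc n. F (coef m1 m2 A z (Suc n) j i) (expo \<alpha> \<beta> (Suc n) j)) =
    (\<Sum>j\<le>n. F (\<Sum>l<m1 + m2. A $$ (i, l) * coef m1 m2 A z n j l)
      (expo \<alpha> \<beta> n j + block_index m1 \<alpha> \<beta> i) :: 'a::comm_monoid_add)"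
proof (cases "i < m1")
  case True
  have "expo \<alpha> \<beta> (Suc n) j = expo \<alpha> \<beta> n j + \<alpha>" if "j \<le> n" for j
    using that by (simp add: expo_def Suc_diff_le algebra_simps)
  then show ?thesis
    using True by (simp add: coef_Suc[OF A i] F block_index_def)
next
  case False
  have "expo \<alpha> \<beta> (Suc n) (Suc j) = expo \<alpha> \<beta> n j + \<beta>" for j
    by (simp add: expo_def algebra_simps)
  then show ?thesis
    using False
    by (subst sum.atMost_Suc_shift) (simp add: coef_Suc[OF A i] F block_index_def)
qed

text \<open>An exponent of generation \<open>n\<close> is a sum of \<open>n\<close> orders, each
  between \<open>min \<alpha> \<beta>\<close> and 1, which gives the bounds \<open>ex_ge\<close> and
  \<open>ex_le\<close>.\<close>

lemma frac_series_coef: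
  assumes "A \<in> carrier_mat (m1 + m2) (m1 + m2)"
    and "0 < \<alpha>" "\<alpha> \<le> 1" "0 < \<beta>" "\<beta> \<le> 1"
  shows "frac_series (m1 + m2) (\<lambda>i l. A $$ (i, l)) (block_index m1 \<alpha> \<beta>) (coef m1 m2 A z)
    (expo \<alpha> \<beta>) (min \<alpha> \<beta>)"
proof
  fix n j :: nat assume j: "j \<le> n"
  have "real n * min \<alpha> \<beta> = real (n - j) * min \<alpha> \<beta> + real j * min \<alpha> \<beta>"
    using j by (simp add: of_nat_diff algebra_simps)
  also have "\<dots> \<le> expo \<alpha> \<beta> n j"
    unfolding expo_def by (intro add_mono mult_left_mono) auto
  finally show "real n * min \<alpha> \<beta> \<le> expo \<alpha> \<beta> n j" .
  have "expo \<alpha> \<beta> n j \<le> real (n - j) * 1 + real j * 1"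
    unfolding expo_def using assms by (intro add_mono mult_left_mono) auto
  then show "expo \<alpha> \<beta> n j \<le> real n"
    using j by (simp add: of_nat_diff)
next
  fix F :: "real \<Rightarrow> real \<Rightarrow> real" and n i :: nat
  assume "\<And>x. F 0 x = 0" "i < m1 + m2"
  then show "(\<Sum>j\<le>Suc n. F (coef m1 m2 A z (Suc n) j i) (expo \<alpha> \<beta> (Suc n) j)) =
      (\<Sum>j\<le>n. F (\<Sum>l<m1 + m2. A $$ (i, l) * coef m1 m2 A z n j l)
        (expo \<alpha> \<beta> n j + block_index m1 \<alpha> \<beta> i))"
    by (intro coef_transfer[OF assms(1)])
qed (use assms in \<open>auto simp: block_index_def expo_def\<close>)

section \<open>Uniqueness and existence for the fractional system\<close>

lemma solves_fde_volterra:
  assumes sol: "solves_fde m1 m2 \<alpha> \<beta> A z y" and A: "A \<in> carrier_mat (m1 + m2) (m1 + m2)"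
    and "0 < \<alpha>" "\<alpha> \<le> 1" "0 < \<beta>" "\<beta> \<le> 1"
    and i: "i < m1 + m2" and t: "0 < t"
  defines "g \<equiv> block_index m1 \<alpha> \<beta> i"
  shows "(LBINT s:{0<..<t}. (t - s) powr (g - 1) * (\<Sum>l<m1 + m2. A $$ (i, l) * y s $ l)) =
    Gamma g * (y t $ i - z $ i)"
proof -
  have eq: "caputo_deriv g (\<lambda>s. y s $ i) s = (\<Sum>l<m1 + m2. A $$ (i, l) * y s $ l)" if "0 < s" for s
  proof -
    have "caputo_deriv g (\<lambda>s. y s $ i) s = caputo_deriv_vec m1 m2 \<alpha> \<beta> y s $ i"
      using i by (simp add: caputo_deriv_vec_def g_def)
    also have "\<dots> = (A *\<^sub>v y s) $ i"
      using sol that by (simp add: solves_fde_def)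
    also have "\<dots> = (\<Sum>l<m1 + m2. A $$ (i, l) * y s $ l)"
      using sol that i A by (intro mult_mat_vec_nth) (auto simp: solves_fde_def)
    finally show ?thesis .
  qed
  have "(LBINT s:{0<..<t}. (t - s) powr (g - 1) * (\<Sum>l<m1 + m2. A $$ (i, l) * y s $ l)) =
      Gamma g * (y t $ i - y 0 $ i)"
    using assms eq
    by (intro caputo_inversion[where u = "\<lambda>s. y s $ i"])
      (auto simp: solves_fde_def block_index_def intro!: continuous_intros)
  then show ?thesis
    using sol by (simp add: solves_fde_def)
qed

text \<open>By linearity the difference of two solutions satisfies the homogeneous Volterra equation
  with initial value 0.\<close>

lemma solves_fde_unique:
  assumes sol: "solves_fde m1 m2 \<alpha> \<beta> A z y" "solves_fde m1 m2 \<alpha> \<beta> A z y'"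
    and A: "A \<in> carrier_mat (m1 + m2) (m1 + m2)"
    and ab: "0 < \<alpha>" "\<alpha> \<le> 1" "0 < \<beta>" "\<beta> \<le> 1"
    and "0 \<le> t"
  shows "y t = y' t"
proof -
  define m where "m = m1 + m2"
  define g where "g = block_index m1 \<alpha> \<beta>"
  have g: "0 < g i" for i
    using ab by (simp add: g_def block_index_def)
  have cont: "continuous_on {0..} (\<lambda>t. x t $ i)"
    if "i < m" "solves_fde m1 m2 \<alpha> \<beta> A z x" for i x
    using that by (auto simp: solves_fde_def m_def)
  have "y t $ i - y' t $ i = 0" if "i < m" for i
  proof (rule volterra_unique[where B = "\<lambda>i l. A $$ (i, l)" and g = g and m = m and T = t])
    fix i :: nat and s :: real assume i: "i < m" and s: "0 < s"
    let ?I = "\<lambda>x r. (s - r) powr (g i - 1) * (\<Sum>l<m. A $$ (i, l) * x r $ l)"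
    \<comment> \<open>Splitting the integral of the difference is legitimate only once both parts
      are integrable.\<close>
    have int: "set_integrable lborel {0<..<s} (?I x)" if "solves_fde m1 m2 \<alpha> \<beta> A z x" for x
      using that g by (intro kernel_integrable) (auto intro!: continuous_intros cont)
    have eq: "(LBINT r:{0<..<s}. ?I x r) = Gamma (g i) * (x s $ i - z $ i)"
      if "solves_fde m1 m2 \<alpha> \<beta> A z x" for x
      using solves_fde_volterra[OF that A ab _ s] i by (simp only: m_def g_def)
    have "(LBINT r:{0<..<s}. (s - r) powr (g i - 1) * (\<Sum>l<m. A $$ (i, l) * (y r $ l - y' r $ l))) =
        (LBINT r:{0<..<s}. ?I y r - ?I y' r)"
      by (simp add: right_diff_distrib sum_subtractf)
    also have "\<dots> = (LBINT r:{0<..<s}. ?I y r) - (LBINT r:{0<..<s}. ?I y' r)"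
      using int sol by (intro set_integral_diff) auto
    also have "\<dots> = Gamma (g i) * (y s $ i - y' s $ i)"
      unfolding eq[OF sol(1)] eq[OF sol(2)] by (simp add: algebra_simps)
    finally show "(LBINT r:{0<..<s}. (s - r) powr (g i - 1) *
      (\<Sum>l<m. A $$ (i, l) * (y r $ l - y' r $ l))) = Gamma (g i) * (y s $ i - y' s $ i)" .
  qed (use g that sol \<open>0 \<le> t\<close> in \<open>auto intro!: continuous_intros cont simp: solves_fde_def\<close>)
  then show ?thesis
    using sol \<open>0 \<le> t\<close> by (intro eq_vecI) (auto simp: solves_fde_def m_def)
qed

theorem theorem7:
  fixes m1 m2 m :: nat and \<alpha> \<beta> :: real and A :: "real Matrix.mat" and z :: "real Matrix.vec"
  assumes "m1 \<ge> 1" and "m2 \<ge> 1" and "m = m1 + m2"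
    and "A \<in> carrier_mat m m" and "z \<in> carrier_vec m"
    and "0 < \<alpha>" and "\<alpha> \<le> 1" and "0 < \<beta>" and "\<beta> \<le> 1"
  shows "(\<forall>t\<ge>0. \<forall>i<m. summable (\<lambda>n. series_term m1 m2 \<alpha> \<beta> A z t n $ i)) \<and>
    solves_fde m1 m2 \<alpha> \<beta> A z (series_solution m1 m2 \<alpha> \<beta> A z) \<and>
    (\<forall>y. solves_fde m1 m2 \<alpha> \<beta> A z y \<longrightarrow>
      (\<forall>t\<ge>0. y t = series_solution m1 m2 \<alpha> \<beta> A z t))"
proof -
  have A: "A \<in> carrier_mat (m1 + m2) (m1 + m2)" and z: "z \<in> carrier_vec (m1 + m2)"
    using assms by auto
  interpret S: frac_series "m1 + m2" "\<lambda>i l. A $$ (i, l)" "block_index m1 \<alpha> \<beta>" "coef m1 m2 A z"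
    "expo \<alpha> \<beta>" "min \<alpha> \<beta>"
    using A assms(6-) by (rule frac_series_coef)
  \<comment> \<open>For \<open>n = 0\<close> the special branches of \<open>p_mat\<close> and
    \<open>S.T\<close> both give the constant \<open>z $ i\<close>; for larger \<open>n\<close> the
    block expansion matches \<open>S.T\<close>.\<close>
  have T: "series_term m1 m2 \<alpha> \<beta> A z t n $ i = S.T n i t" if "i < m1 + m2" for t n i
    using series_term_nth[OF A z] that by (simp add: S.T_def series_term_0[OF z] coef_0)
  have y: "series_solution m1 m2 \<alpha> \<beta> A z t $ i = S.y i t" if "i < m1 + m2" for t i
    using that by (simp add: series_solution_def S.y_def T)
  have sol: "solves_fde m1 m2 \<alpha> \<beta> A z (series_solution m1 m2 \<alpha> \<beta> A z)"
    unfolding solves_fde_def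
  proof (intro conjI allI impI)
    show carrier: "series_solution m1 m2 \<alpha> \<beta> A z t \<in> carrier_vec (m1 + m2)" for t
      by (simp add: series_solution_def)
    show "series_solution m1 m2 \<alpha> \<beta> A z 0 = z"
      using z carrier[of 0] by (intro eq_vecI) (auto simp: y S.y_0 coef_0)
    show "continuous_on {0..} (\<lambda>t. series_solution m1 m2 \<alpha> \<beta> A z t $ i)" if "i < m1 + m2" for i
      using S.continuous_on_y[OF that] by (simp add: y that)
    fix t :: real assume t: "0 < t"
    show "caputo_differentiable (block_index m1 \<alpha> \<beta> i) (\<lambda>s. series_solution m1 m2 \<alpha> \<beta> A z s $ i) t"
      if "i < m1 + m2" for i
      using S.caputo_y(1)[OF that t] by (simp add: y that)
    show "caputo_deriv_vec m1 m2 \<alpha> \<beta> (series_solution m1 m2 \<alpha> \<beta> A z) t =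
        A *\<^sub>v series_solution m1 m2 \<alpha> \<beta> A z t"
      using A carrier
      by (intro eq_vecI)
        (auto simp: caputo_deriv_vec_def mult_mat_vec_nth[OF A carrier] y S.caputo_y(2)[OF _ t]
          simp del: index_mult_mat_vec)
  qed
  show ?thesis
    using sol solves_fde_unique[OF _ sol A assms(6-)] S.summable_T T assms(3) by auto
qed

end
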